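(* Let $p\ge3$, let $a_1,\ldots,a_p\in C_{2\pi}$ be the symbols of positive definite matrices $A_1,\ldots,A_p\in\mathcal{QT}$, and let $a_i^{(k)}$, for $i=1,\ldots,p$ and $k=0,1,2,\ldots$, be the sequences obtained by the ALM iteration applied to $a_1,\ldots,a_p$. Suppose that one of the following conditions is fulfilled for all $i=1,\ldots,p$: (a) $a_i\in C_{2\pi}^{0,\alpha}$, with $\alpha\in(\frac12,1]$; (b) $a_i\in C_{2\pi}^{0,\alpha}$, with $\alpha\in(0,1]$, and $a_i$ is of bounded variation on $[0,2\pi]$; (c) $a_i$ is absolutely continuous on $[0,2\pi]$ with derivative in $L^2([0,2\pi])$. Then $a_i^{(k)}\in\mathcal W$ for all $i$ and $k$, $(a_1\cdots a_p)^{1/p}\in\mathcal W$, and $\lim_{k}\|a_i^{(k)}-(a_1\cdots a_p)^{1/p}\|_{\mathcal W}=0$ for $i=1,\ldots,p$.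
   Context: $\ell^2$ is the complex Hilbert space of square-summable sequences indexed by the positive integers. $C_{2\pi}$ is the set of continuous $a:[0,2\pi]\to\mathbb C$ with $a(0)=a(2\pi)$ (identified with $2\pi$-periodic continuous functions on $\mathbb R$). For $a\in C_{2\pi}$ with Fourier series $\sum_{k}a_ke^{\mathrm{i}kt}$, $T(a)$ is the bounded operator on $\ell^2$ with matrix $(T(a))_{i,j}=a_{j-i}$, $i,j\ge1$. $\mathcal{QT}=\{T(a)+K: a\in C_{2\pi},\ K \text{ compact on }\ell^2\}$; the decomposition $A=T(a)+K$ of $A\in\mathcal{QT}$ is unique and $a$ is called the symbol of $A$. A bounded operator $A$ is positive definite if it is self-adjoint and there is $\gamma>0$ with $v^*Av\ge\gamma\|v\|_2^2$ for all $v\in\ell^2$; its symbol, if $A\in\mathcal{QT}$, is then strictly positive. $\mathcal W$ is the Wiener algebra of $2\pi$-periodic functions $f=\sum_{k\in\mathbb Z}f_ke^{\mathrm{i}kt}$ with absolutely convergent Fourier series, with norm $\|f\|_{\mathcal W}=\sum_{k\in\mathbb Z}|f_k|$. $C_{2\pi}^{0,\alpha}$ ($0<\alpha\le1$) is the set of $2\pi$-periodic functions $\varphi$ on $\mathbb R$ with $\sup_{x\ne y}|\varphi(x)-\varphi(y)|/|x-y|^\alpha<\infty$. ALM iteration for positive functions (everything pointwise): the ALM mean of two positive functions is $G(a,b)=(ab)^{1/2}$; for $p\ge3$ positive functions, the ALM iteration is $a_i^{(0)}=a_i$, $a_i^{(k+1)}=G(a_1^{(k)},\ldots,a_{i-1}^{(k)},a_{i+1}^{(k)},\ldots,a_p^{(k)})$,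 $i=1,\ldots,p$, where $G$ of $p-1$ functions is the ALM mean of $p-1$ functions, and the ALM mean of $p$ functions is the common limit of these $p$ sequences. Equivalently, $a_i^{(k+1)}=\bigl(\prod_{j\ne i}a_j^{(k)}\bigr)^{1/(p-1)}$. *)

theory Defs
  imports "HOL-Analysis.Analysis"
begin

text \<open>
  Coordinates are indexed from \<open>0\<close> instead of \<open>1\<close>. Toeplitz matrices only depend on the
  difference of the indices, so their definition is not affected by this shift.
\<close>

typedef ell2 = "{x :: nat \<Rightarrow> complex. summable (\<lambda>n. (norm (x n))\<^sup>2)}"
  morphisms coord Abs_ell2
  by (rule exI[of _ "\<lambda>_. 0"]) simp

setup_lifting type_definition_ell2

lemma ell2_eqI: "(\<And>n. coord x n = coord y n) \<Longrightarrow> x = y"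
  by (metis coord_inject ext)

lemma summable_coord: "summable (\<lambda>n. (norm (coord x n))\<^sup>2)"
  using coord[of x] by simp

lemma norm_sum_sq_le: "(norm (u + v :: complex))\<^sup>2 \<le> 2 * (norm u)\<^sup>2 + 2 * (norm v)\<^sup>2"
proof -
  have "(norm (u + v))\<^sup>2 \<le> (norm u + norm v)\<^sup>2"
    by (simp add: norm_triangle_ineq power_mono)
  also have "\<dots> \<le> 2 * (norm u)\<^sup>2 + 2 * (norm v)\<^sup>2"
    using sum_squares_bound[of "norm u" "norm v"] by (simp add: power2_sum)
  finally show ?thesis .
qed

lemma summable_norm_sq_add:
  fixes x y :: "nat \<Rightarrow> complex"
  assumes "summable (\<lambda>n. (norm (x n))\<^sup>2)" "summable (\<lambda>n. (norm (y n))\<^sup>2)"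
  shows "summable (\<lambda>n. (norm (x n + y n))\<^sup>2)"
proof (rule summable_comparison_test)
  show "summable (\<lambda>n. 2 * (norm (x n))\<^sup>2 + 2 * (norm (y n))\<^sup>2)"
    using assms by (intro summable_add summable_mult)
  show "\<exists>N. \<forall>n\<ge>N. norm ((norm (x n + y n))\<^sup>2) \<le> 2 * (norm (x n))\<^sup>2 + 2 * (norm (y n))\<^sup>2"
    using norm_sum_sq_le by auto
qed

lemma summable_norm_sq_mult:
  fixes x :: "nat \<Rightarrow> complex"
  assumes "summable (\<lambda>n. (norm (x n))\<^sup>2)"
  shows "summable (\<lambda>n. (norm (c * x n))\<^sup>2)"
  using summable_mult[OF assms, of "(norm c)\<^sup>2"] by (simp add: norm_mult power_mult_distrib)

lift_definition scaleC_ell2 :: "complex \<Rightarrow> ell2 \<Rightarrow> ell2" is "\<lambda>c x n. c * x n"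
  by (rule summable_norm_sq_mult)

lift_definition unit_vec :: "nat \<Rightarrow> ell2" is "\<lambda>j n. if n = j then 1 else 0"
  by (rule summable_finite[of "{j}" for j]) auto

definition cinner_ell2 :: "ell2 \<Rightarrow> ell2 \<Rightarrow> complex" where
  "cinner_ell2 x y = (\<Sum>n. cnj (coord x n) * coord y n)"

lemma summable_cinner: "summable (\<lambda>n. cnj (coord x n) * coord y n)"
proof (rule summable_comparison_test)
  show "summable (\<lambda>n. (norm (coord x n))\<^sup>2 + (norm (coord y n))\<^sup>2)"
    by (intro summable_add summable_coord)
  have "norm (cnj u * v) \<le> (norm u)\<^sup>2 + (norm v)\<^sup>2" for u v :: complex
  proof -
    have "0 \<le> norm u * norm v"
      by simp
    then show ?thesis
      using sum_squares_bound[of "norm u" "norm v"]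
      unfolding norm_mult complex_mod_cnj by linarith
  qed
  then show "\<exists>N. \<forall>n\<ge>N. norm (cnj (coord x n) * coord y n)
      \<le> (norm (coord x n))\<^sup>2 + (norm (coord y n))\<^sup>2"
    by blast
qed

instantiation ell2 :: real_vector
begin

lift_definition zero_ell2 :: ell2 is "\<lambda>_. 0" by simp

lift_definition plus_ell2 :: "ell2 \<Rightarrow> ell2 \<Rightarrow> ell2" is "\<lambda>x y n. x n + y n"
  by (rule summable_norm_sq_add)

lift_definition uminus_ell2 :: "ell2 \<Rightarrow> ell2" is "\<lambda>x n. - x n" by simp

lift_definition minus_ell2 :: "ell2 \<Rightarrow> ell2 \<Rightarrow> ell2" is "\<lambda>x y n. x n - y n"
  using summable_norm_sq_add[of _ "\<lambda>n. - y n" for y] by simp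

lift_definition scaleR_ell2 :: "real \<Rightarrow> ell2 \<Rightarrow> ell2" is "\<lambda>r x n. r *\<^sub>R x n"
  unfolding scaleR_conv_of_real by (rule summable_norm_sq_mult)

instance
  by standard (transfer; simp add: fun_eq_iff algebra_simps)+

end

lemma coord_simps [simp]:
  "coord 0 n = 0"
  "coord (x + y) n = coord x n + coord y n"
  "coord (- x) n = - coord x n"
  "coord (x - y) n = coord x n - coord y n"
  "coord (r *\<^sub>R x) n = r *\<^sub>R coord x n"
  "coord (scaleC_ell2 c x) n = c * coord x n"
  "coord (unit_vec j) n = (if n = j then 1 else 0)"
  by (transfer; simp)+

instantiation ell2 :: real_inner
begin

definition inner_ell2 :: "ell2 \<Rightarrow> ell2 \<Rightarrow> real" where
  "inner_ell2 x y = Re (cinner_ell2 x y)"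

definition norm_ell2 :: "ell2 \<Rightarrow> real" where
  "norm_ell2 x = sqrt (\<Sum>n. (norm (coord x n))\<^sup>2)"

definition dist_ell2 :: "ell2 \<Rightarrow> ell2 \<Rightarrow> real" where
  "dist_ell2 x y = norm (x - y)"

definition sgn_ell2 :: "ell2 \<Rightarrow> ell2" where
  "sgn_ell2 x = x /\<^sub>R norm x"

definition uniformity_ell2 :: "(ell2 \<times> ell2) filter" where
  "uniformity_ell2 = (INF e\<in>{0<..}. principal {(x, y). dist x y < e})"

definition open_ell2 :: "ell2 set \<Rightarrow> bool" where
  "open_ell2 U \<longleftrightarrow> (\<forall>x\<in>U. \<forall>\<^sub>F (x', y) in uniformity. x' = x \<longrightarrow> y \<in> U)"

instance
proof
  fix x y z :: ell2 and r :: real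
  have inner_sum: "inner u v = (\<Sum>n. Re (cnj (coord u n) * coord v n))" for u v :: ell2
    unfolding inner_ell2_def cinner_ell2_def by (rule Re_suminf[OF summable_cinner])
  have summ: "summable (\<lambda>n. Re (cnj (coord u n) * coord v n))" for u v :: ell2
    by (rule summable_Re[OF summable_cinner])
  have inner_self: "inner u u = (\<Sum>n. (norm (coord u n))\<^sup>2)" for u :: ell2
    unfolding inner_sum cmod_power2 by (simp add: power2_eq_square)
  show "dist x y = norm (x - y)" by (rule dist_ell2_def)
  show "sgn x = x /\<^sub>R norm x" by (rule sgn_ell2_def)
  show "uniformity = (INF e\<in>{0<..}. principal {(x::ell2, y). dist x y < e})"
    by (rule uniformity_ell2_def)
  show "open U \<longleftrightarrow> (\<forall>x\<in>U. \<forall>\<^sub>F (x', y) in uniformity. x' = x \<longrightarrow> y \<in> U)"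
    for U :: "ell2 set" by (rule open_ell2_def)
  show "inner x y = inner y x"
    unfolding inner_sum by (simp add: mult.commute)
  show "inner (x + y) z = inner x z + inner y z"
    unfolding inner_sum suminf_add[OF summ summ] by (simp add: algebra_simps)
  show "inner (r *\<^sub>R x) y = r * inner x y"
    unfolding inner_sum suminf_mult[OF summ, symmetric] by (simp add: algebra_simps)
  show "0 \<le> inner x x"
    unfolding inner_self by (rule suminf_nonneg[OF summable_coord]) simp
  show "inner x x = 0 \<longleftrightarrow> x = 0"
    unfolding inner_self using suminf_eq_zero_iff[OF summable_coord[of x]]
    by (auto intro: ell2_eqI)
  show "norm x = sqrt (inner x x)"
    unfolding inner_self by (rule norm_ell2_def)
qed

end

definition bounded_op :: "(ell2 \<Rightarrow> ell2) \<Rightarrow> bool" where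
  "bounded_op A \<longleftrightarrow> bounded_linear A \<and> (\<forall>c x. A (scaleC_ell2 c x) = scaleC_ell2 c (A x))"

definition compact_op :: "(ell2 \<Rightarrow> ell2) \<Rightarrow> bool" where
  "compact_op K \<longleftrightarrow> bounded_op K \<and> compact (closure (K ` cball 0 1))"

definition self_adjoint :: "(ell2 \<Rightarrow> ell2) \<Rightarrow> bool" where
  "self_adjoint A \<longleftrightarrow> (\<forall>x y. cinner_ell2 (A x) y = cinner_ell2 x (A y))"

text \<open>For self-adjoint \<open>A\<close> the number \<open>cinner_ell2 v (A v)\<close> is real.\<close>

definition positive_definite :: "(ell2 \<Rightarrow> ell2) \<Rightarrow> bool" where
  "positive_definite A \<longleftrightarrow> bounded_op A \<and> self_adjoint A \<and>
     (\<exists>\<gamma>>0. \<forall>v. Re (cinner_ell2 v (A v)) \<ge> \<gamma> * (norm v)\<^sup>2)"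

definition periodic :: "(real \<Rightarrow> complex) \<Rightarrow> bool" where
  "periodic f \<longleftrightarrow> (\<forall>t. f (t + 2 * pi) = f t)"

definition C_2pi :: "(real \<Rightarrow> complex) set" where
  "C_2pi = {f. continuous_on UNIV f \<and> periodic f}"

definition fourier_coeff :: "(real \<Rightarrow> complex) \<Rightarrow> int \<Rightarrow> complex" where
  "fourier_coeff f k = integral {0..2 * pi} (\<lambda>t. f t * cis (- (of_int k * t))) / (2 * pi)"

text \<open>\<open>T\<close> is the bounded operator with matrix entries \<open>a\<^sub>j\<^sub>-\<^sub>i\<close>; it is determined by \<open>a\<close>, because
  a bounded operator is determined by its matrix.\<close>

definition toeplitz_op :: "(real \<Rightarrow> complex) \<Rightarrow> (ell2 \<Rightarrow> ell2) \<Rightarrow> bool" where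
  "toeplitz_op a T \<longleftrightarrow> bounded_op T \<and>
     (\<forall>i j. coord (T (unit_vec j)) i = fourier_coeff a (int j - int i))"

definition has_symbol :: "(ell2 \<Rightarrow> ell2) \<Rightarrow> (real \<Rightarrow> complex) \<Rightarrow> bool" where
  "has_symbol A a \<longleftrightarrow> a \<in> C_2pi \<and>
     (\<exists>T K. toeplitz_op a T \<and> compact_op K \<and> A = (\<lambda>x. T x + K x))"

definition QT :: "(ell2 \<Rightarrow> ell2) set" where
  "QT = {A. \<exists>a. has_symbol A a}"

definition wiener :: "(real \<Rightarrow> complex) set" where
  "wiener = {f. periodic f \<and> (\<lambda>k. norm (fourier_coeff f k)) summable_on UNIV \<and>
     (\<forall>t. ((\<lambda>k. fourier_coeff f k * cis (of_int k * t)) has_sum f t) UNIV)}"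

definition wiener_norm :: "(real \<Rightarrow> complex) \<Rightarrow> real" where
  "wiener_norm f = (\<Sum>\<^sub>\<infinity>k. norm (fourier_coeff f k))"

definition holder_2pi :: "real \<Rightarrow> (real \<Rightarrow> complex) set" where
  "holder_2pi \<alpha> = {f. periodic f \<and>
     bdd_above {norm (f x - f y) / \<bar>x - y\<bar> powr \<alpha> | x y. x \<noteq> y}}"

definition bounded_variation_on :: "real \<Rightarrow> real \<Rightarrow> (real \<Rightarrow> complex) \<Rightarrow> bool" where
  "bounded_variation_on l u f \<longleftrightarrow>
     (\<exists>B. \<forall>n x. mono x \<and> range x \<subseteq> {l..u} \<longrightarrow>
        (\<Sum>i<(n::nat). norm (f (x (Suc i)) - f (x i))) \<le> B)"

text \<open>\<open>D\<close> ranges over the finite families of non-overlapping closed subintervals of \<open>[l, u]\<close>.\<close>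

definition abs_continuous_on :: "real \<Rightarrow> real \<Rightarrow> (real \<Rightarrow> complex) \<Rightarrow> bool" where
  "abs_continuous_on l u f \<longleftrightarrow>
     (\<forall>\<epsilon>>0. \<exists>\<delta>>0. \<forall>D. D division_of \<Union>D \<and> \<Union>D \<subseteq> {l..u} \<and> (\<Sum>I\<in>D. Sup I - Inf I) < \<delta> \<longrightarrow>
        (\<Sum>I\<in>D. norm (f (Sup I) - f (Inf I))) < \<epsilon>)"

text \<open>The derivative is the almost everywhere defined one.\<close>

definition L2_derivative_on :: "real \<Rightarrow> real \<Rightarrow> (real \<Rightarrow> complex) \<Rightarrow> bool" where
  "L2_derivative_on l u f \<longleftrightarrow>
     (\<exists>g. (AE t in lebesgue_on {l..u}. (f has_vector_derivative g t) (at t)) \<and>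
        g \<in> borel_measurable (lebesgue_on {l..u}) \<and>
        integrable (lebesgue_on {l..u}) (\<lambda>t. (norm (g t))\<^sup>2))"

text \<open>
  Values are complex because symbols are complex-valued functions. For positive arguments, \<open>csqrt\<close>
  and complex \<open>powr\<close> are the usual positive roots. A family of \<open>p\<close> numbers is a function on
  \<open>{..<p}\<close>, and \<open>omit i x\<close> is the family \<open>x\<^sub>0, \<dots>, x\<^sub>i\<^sub>-\<^sub>1, x\<^sub>i\<^sub>+\<^sub>1, \<dots>\<close>.
\<close>

definition omit :: "nat \<Rightarrow> (nat \<Rightarrow> 'a) \<Rightarrow> nat \<Rightarrow> 'a" where
  "omit i x = (\<lambda>j. if j < i then x j else x (Suc j))"

primrec alm_iter :: "((nat \<Rightarrow> complex) \<Rightarrow> complex) \<Rightarrow> (nat \<Rightarrow> complex) \<Rightarrow> nat \<Rightarrow> nat \<Rightarrow> complex" where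
  "alm_iter G x 0 = x"
| "alm_iter G x (Suc k) = (\<lambda>i. G (omit i (alm_iter G x k)))"

text \<open>\<open>alm_mean p\<close> is the mean of \<open>p\<close> numbers; the values for \<open>p < 2\<close> are irrelevant.\<close>

primrec alm_mean :: "nat \<Rightarrow> (nat \<Rightarrow> complex) \<Rightarrow> complex" where
  "alm_mean 0 = (\<lambda>x. 1)"
| "alm_mean (Suc p) = (\<lambda>x.
     if p \<le> 1 then csqrt (x 0 * x 1)
     else (THE l. \<forall>i<Suc p. (\<lambda>k. alm_iter (alm_mean p) x k i) \<longlonglongrightarrow> l))"

definition alm_seq ::
  "nat \<Rightarrow> (nat \<Rightarrow> real \<Rightarrow> complex) \<Rightarrow> nat \<Rightarrow> nat \<Rightarrow> real \<Rightarrow> complex" where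
  "alm_seq p a k i = (\<lambda>t. alm_iter (alm_mean (p - 1)) (\<lambda>j. a j t) k i)"

end

theory Submission
  imports Defs
begin

text \<open>
  The quadratic forms of \<open>A i\<close> on vectors moved to infinity converge to those of the Toeplitz part,
  so testing with the coefficients of \<open>(1 + e\<^sup>i\<^sup>t)\<^sup>n\<close> shows that the symbols are bounded below by positive
  constants. All three smoothness conditions imply an estimate
  \<open>\<bar>f y - f x\<bar>\<^sup>2 \<le> (y - x)\<^sup>\<beta> (G y - G x)\<close> with a monotone \<open>G\<close>, which can be chosen common to all the
  symbols and is preserved, up to a constant factor, by Lipschitz functions. Summed over a period, it
  bounds the quadratic modulus of continuity by \<open>O(h\<^sup>1\<^sup>+\<^sup>\<beta>)\<close>, and Bernstein's dyadic argument bounds the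
  Wiener norm. With \<open>l\<^sub>i = ln a\<^sub>i\<close> and their average \<open>m\<close>, the iterates are
  \<open>exp (m + r\<^sup>k (l\<^sub>i - m))\<close> for \<open>r = -1/(p - 1)\<close>, so their distance to the limit \<open>exp m\<close> satisfies the
  estimate with a constant of order \<open>\<bar>r\<bar>\<^sup>k\<close>.
\<close>

subsection \<open>Smoothness conditions\<close>

text \<open>Uniform convergence of the iterates says nothing about the Wiener norm, and the Wiener
  norm is hard to control under nonlinear maps such as \<open>ln\<close> and \<open>exp\<close>.
  Increments, by contrast, pass through Lipschitz maps. So everything nonlinear is done on
  increments, and Fourier analysis enters through a single estimate that is linear in the size of
  the function.

  The squared increment is compared with an increment of a monotone \<open>G\<close> because the
  integral of G (t + h) - G t telescopes to O(h), however irregular \<open>G\<close> is. By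
  Cauchy-Schwarz a block of about 2^m coefficients costs a factor 2^m, against 2^(-m (1 + \<beta>))
  gained from the step h of order 2^(-m); any \<beta> > 0 leaves a convergent geometric series. The
  threshold 1/2 has the same origin: a Hoelder function has squared increments of order 2 \<alpha>,
  and one unit of this exponent is spent on \<open>G\<close>.

  The lower bounds on the symbols make \<open>ln\<close> Lipschitz. They have to be read off far
  down the diagonals of the matrices, since the compact part can alter any finite section.\<close>

lemma abs_continuous_on_subinterval:
  assumes "abs_continuous_on l u f" "l \<le> l'" "u' \<le> u"
  shows "abs_continuous_on l' u' f"
proof -
  have "{l'..u'} \<subseteq> {l..u}"
    using assms(2,3) by auto
  then show ?thesis
    using assms(1) unfolding abs_continuous_on_def by (meson subset_trans)
qed

text \<open>Tags in the exceptional null set are made fine inside an open set of small measure,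
  where absolute continuity controls the increments.\<close>

lemma abs_continuous_on_has_integral:
  fixes f :: "real \<Rightarrow> complex"
  assumes ac: "abs_continuous_on l u f" and lu: "l \<le> u" and N: "negligible N"
    and deriv: "\<And>t. t \<in> {l..u} - N \<Longrightarrow> (f has_vector_derivative g t) (at t)"
  shows "(g has_integral (f u - f l)) {l..u}"
proof -
  \<comment> \<open>The value 0 on \<open>N\<close> leaves only the increment of \<open>f\<close> at
    a tag in \<open>N\<close>, which absolute continuity controls; the values of \<open>g\<close>
    there are arbitrary.\<close>
  define g' where "g' = (\<lambda>t. if t \<in> N then 0 else g t)"
  have "(g' has_integral (f u - f l)) {l..u}"
    unfolding has_integral_real
  proof (intro allI impI)
    fix e :: real assume e: "e > 0"
    define e1 where "e1 = e / (2 * (u - l + 1))"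
    have e1: "e1 > 0" "e1 * (u - l) < e / 2"
      using e lu unfolding e1_def by (auto simp: field_simps)
    obtain \<delta> where \<delta>: "\<delta> > 0" "\<And>D. D division_of \<Union>D \<Longrightarrow> \<Union>D \<subseteq> {l..u} \<Longrightarrow>
        (\<Sum>I\<in>D. Sup I - Inf I) < \<delta> \<Longrightarrow> (\<Sum>I\<in>D. norm (f (Sup I) - f (Inf I))) < e / 2"
      using ac e unfolding abs_continuous_on_def by (meson half_gt_zero)
    have Nsets: "N \<in> sets lebesgue"
      using N negligible_iff_null_sets by blast
    obtain T where T: "open T" "N \<subseteq> T" "T - N \<in> lmeasurable" "emeasure lebesgue (T - N) < ennreal \<delta>"
      using sets_lebesgue_outer_open[OF Nsets \<delta>(1)] by blast
    have Tm: "T \<in> lmeasurable" "measure lebesgue T < \<delta>"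
    proof -
      have N0: "N \<in> null_sets lebesgue"
        using N negligible_iff_null_sets by blast
      have "T = (T - N) \<union> N"
        using T(2) by blast
      moreover have "(T - N) \<union> N \<in> lmeasurable"
        using T(3) N0 by (intro fmeasurable.Un) (auto simp: fmeasurable_def)
      moreover have "measure lebesgue ((T - N) \<union> N) = measure lebesgue (T - N)"
        by (rule measure_Un_null_set[OF fmeasurableD[OF T(3)] N0])
      moreover have "measure lebesgue (T - N) < \<delta>"
        using T(3,4) \<delta>(1) by (simp add: emeasure_eq_measure2 fmeasurableD ennreal_less_iff)
      ultimately show "T \<in> lmeasurable" "measure lebesgue T < \<delta>"
        by metis+
    qed
    have "\<exists>d>0. (t \<in> {l..u} - N \<longrightarrow> (\<forall>y. \<bar>y - t\<bar> < d \<longrightarrow>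
             norm (f y - f t - (y - t) *\<^sub>R g t) \<le> e1 * \<bar>y - t\<bar>)) \<and> (t \<in> N \<longrightarrow> ball t d \<subseteq> T)" for t
    proof (cases "t \<in> N")
      case True
      then show ?thesis
        using T(1,2) by (meson DiffE in_mono open_contains_ball)
    next
      case False
      show ?thesis
      proof (cases "t \<in> {l..u}")
        case True
        then have "(f has_vector_derivative g t) (at t)"
          using False deriv by blast
        then show ?thesis
          using False e1(1) unfolding has_vector_derivative_def has_derivative_at_alt real_norm_def
          by blast
      qed (auto intro: exI[of _ 1] simp: False)
    qed
    then obtain d where d: "\<And>t. d t > 0"
      "\<And>t y. t \<in> {l..u} - N \<Longrightarrow> \<bar>y - t\<bar> < d t \<Longrightarrow>
          norm (f y - f t - (y - t) *\<^sub>R g t) \<le> e1 * \<bar>y - t\<bar>"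
      "\<And>t. t \<in> N \<Longrightarrow> ball t (d t) \<subseteq> T"
      by metis
    show "\<exists>\<gamma>. gauge \<gamma> \<and> (\<forall>\<D>. \<D> tagged_division_of {l..u} \<and> \<gamma> fine \<D> \<longrightarrow>
        norm ((\<Sum>(x, k)\<in>\<D>. measure lborel k *\<^sub>R g' x) - (f u - f l)) < e)"
    proof (intro exI conjI allI impI)
      show "gauge (\<lambda>x. ball x (d x))"
        using d(1) gauge_ball_dependent by blast
      fix p assume "p tagged_division_of {l..u} \<and> (\<lambda>x. ball x (d x)) fine p"
      then have p: "p tagged_division_of {l..u}" and fine: "(\<lambda>x. ball x (d x)) fine p"
        by blast+
      have finp: "finite p"
        using tagged_division_ofD(1)[OF p] .
      have ba: "u - l = (\<Sum>(x,K)\<in>p. Sup K - Inf K)" "f u - f l = (\<Sum>(x,K)\<in>p. f (Sup K) - f (Inf K))"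
        using additive_tagged_division_1[where f= "\<lambda>x. x", OF lu p]
          additive_tagged_division_1[where f= f, OF lu p] by auto
      define q where "q = {(x, K) \<in> p. x \<in> N}"
      have q: "q tagged_partial_division_of {l..u}"
        by (rule tagged_partial_division_subset[of p]) (use p in \<open>auto simp: tagged_division_of_def q_def\<close>)
      have qp: "q \<subseteq> p"
        unfolding q_def by auto
      have interval: "\<exists>a b. K = {a..b} \<and> a \<le> x \<and> x \<le> b \<and> {a..b} \<subseteq> {l..u} \<and> {a..b} \<subseteq> ball x (d x)"
        if xK: "(x, K) \<in> p" for x K
      proof -
        obtain a b where K: "K = cbox a b"
          using tagged_division_ofD(4)[OF p xK] by blast
        have "x \<in> K" "K \<subseteq> {l..u}" "K \<subseteq> ball x (d x)"
          using tagged_division_ofD(2,3)[OF p xK] fineD[OF fine xK] by auto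
        then show ?thesis
          using K by auto
      qed
      have "norm ((\<Sum>(x, k)\<in>p. measure lborel k *\<^sub>R g' x) - (f u - f l))
          = norm (\<Sum>(x, k)\<in>p. measure lborel k *\<^sub>R g' x - (f (Sup k) - f (Inf k)))"
        unfolding ba by (simp add: sum_subtractf split_def)
      also have "\<dots> \<le> (\<Sum>(x, k)\<in>p. e1 * (Sup k - Inf k)
          + (if x \<in> N then norm (f (Sup k) - f (Inf k)) else 0))"
      proof (rule sum_norm_le, safe)
        fix x K assume xK: "(x, K) \<in> p"
        obtain a b where K: "K = {a..b}" "a \<le> x" "x \<le> b" "{a..b} \<subseteq> {l..u}" "{a..b} \<subseteq> ball x (d x)"
          using interval[OF xK] by blast
        then have SI: "Sup K = b" "Inf K = a" "a \<le> b" "measure lborel K = b - a"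
          by auto
        show "norm (measure lborel K *\<^sub>R g' x - (f (Sup K) - f (Inf K)))
            \<le> e1 * (Sup K - Inf K) + (if x \<in> N then norm (f (Sup K) - f (Inf K)) else 0)"
        proof (cases "x \<in> N")
          case True
          then show ?thesis
            using e1 SI by (simp add: g'_def norm_minus_commute)
        next
          case False
          have "a \<in> {a..b}" "b \<in> {a..b}" "x \<in> {a..b}"
            using K by auto
          then have ab: "a \<in> ball x (d x)" "b \<in> ball x (d x)" "x \<in> {l..u}"
            using K by blast+
          have "norm ((b - a) *\<^sub>R g x - (f b - f a))
              = norm ((f a - f x - (a - x) *\<^sub>R g x) - (f b - f x - (b - x) *\<^sub>R g x))"
            by (auto simp: algebra_simps)
          also have "\<dots> \<le> e1 * \<bar>a - x\<bar> + e1 * \<bar>b - x\<bar>"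
            using ab False by (intro order_trans[OF norm_triangle_ineq4] add_mono d(2))
              (auto simp: dist_real_def)
          also have "\<dots> = e1 * (b - a)"
            using K by (simp add: algebra_simps)
          finally show ?thesis
            using False SI by (simp add: g'_def)
        qed
      qed
      also have "\<dots> = e1 * (u - l) + (\<Sum>(x, k)\<in>p. if x \<in> N then norm (f (Sup k) - f (Inf k)) else 0)"
        unfolding ba by (simp add: sum.distrib sum_distrib_left split_def)
      also have "(\<Sum>(x, k)\<in>p. if x \<in> N then norm (f (Sup k) - f (Inf k)) else 0)
          = (\<Sum>(x, k)\<in>q. norm (f (Sup k) - f (Inf k)))"
        unfolding q_def by (rule sum.mono_neutral_cong_right) (use finp in \<open>auto split: if_splits\<close>)
      \<comment> \<open>Passing from tagged intervals to intervals asks for a summand that vanishes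
        on boxes with empty interior. \<open>Sup {}\<close> and \<open>Inf {}\<close> carry no
        information, hence the guard; it never fires, since each interval contains its tag.\<close>
      also have "\<dots> = (\<Sum>(x, k)\<in>q. if k = {} then 0 else norm (f (Sup k) - f (Inf k)))"
        using interval qp by (intro sum.cong) fastforce+
      also have "\<dots> = (\<Sum>k\<in>snd ` q. if k = {} then 0 else norm (f (Sup k) - f (Inf k)))"
      proof (rule sum.over_tagged_division_lemma)
        show "q tagged_division_of \<Union>(snd ` q)"
          using tagged_partial_division_of_Union_self[OF q] by simp
        show "(if cbox a b = {} then 0 else norm (f (Sup (cbox a b)) - f (Inf (cbox a b)))) = 0"
          if "box a b = {}" for a b :: real
        proof -
          have "b \<le> a"
            using that by (simp add: box_eq_empty)
          then show ?thesis
            by (cases "a = b") auto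
        qed
      qed
      also have "\<dots> = (\<Sum>k\<in>snd ` q. norm (f (Sup k) - f (Inf k)))"
        using interval qp by (intro sum.cong) fastforce+
      also have "\<dots> < e / 2"
      proof (rule \<delta>(2))
        show div: "snd ` q division_of \<Union>(snd ` q)"
          using partial_division_of_tagged_division[OF q] .
        show "\<Union>(snd ` q) \<subseteq> {l..u}"
          using q unfolding tagged_partial_division_of_def by force
        have "(\<Sum>I\<in>snd ` q. Sup I - Inf I) = (\<Sum>I\<in>snd ` q. measure lebesgue I)"
        proof (rule sum.cong)
          fix I assume "I \<in> snd ` q"
          then obtain x where "(x, I) \<in> p"
            using qp by auto
          then show "Sup I - Inf I = measure lebesgue I"
            using interval by fastforce
        qed simp
        also have "\<dots> = measure lebesgue (\<Union>(snd ` q))"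
          by (rule content_division[OF div])
        also have "\<dots> \<le> measure lebesgue T"
        proof (rule measure_mono_fmeasurable)
          show "\<Union>(snd ` q) \<subseteq> T"
            using interval d(3) unfolding q_def by fastforce
          show "\<Union>(snd ` q) \<in> sets lebesgue"
            using lmeasurable_division[OF div] by blast
        qed (rule Tm)
        also have "\<dots> < \<delta>"
          by (rule Tm)
        finally show "(\<Sum>I\<in>snd ` q. Sup I - Inf I) < \<delta>" .
      qed
      finally show "norm ((\<Sum>(x, k)\<in>p. measure lborel k *\<^sub>R g' x) - (f u - f l)) < e"
        using e1 by linarith
    qed
  qed
  then show ?thesis
    by (rule has_integral_spike[OF N, rotated]) (simp add: g'_def)
qed

text \<open>The common weakening of the three smoothness hypotheses: up to constants, \<open>G\<close> is the
  identity in the Hoelder case, the variation of \<open>f\<close> in the second case, and the integral of the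
  squared derivative in the third.\<close>

definition modulus_bound :: "real \<Rightarrow> (real \<Rightarrow> real) \<Rightarrow> (real \<Rightarrow> complex) \<Rightarrow> bool" where
  "modulus_bound \<beta> G f \<longleftrightarrow> mono_on {0..2 * pi} G \<and>
     (\<forall>x y. 0 \<le> x \<longrightarrow> x \<le> y \<longrightarrow> y \<le> 2 * pi \<longrightarrow>
        (norm (f y - f x))\<^sup>2 \<le> (y - x) powr \<beta> * (G y - G x))"

section \<open>The modulus bound under each of the three smoothness conditions\<close>

lemma holder_2pi_bound:
  assumes "f \<in> holder_2pi \<alpha>"
  obtains C where "C > 0" "\<And>x y. x \<le> y \<Longrightarrow> norm (f y - f x) \<le> C * (y - x) powr \<alpha>"
proof -
  obtain C where C: "\<And>x y. x \<noteq> y \<Longrightarrow> norm (f x - f y) / \<bar>x - y\<bar> powr \<alpha> \<le> C"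
    using assms unfolding holder_2pi_def bdd_above_def by blast
  have "norm (f y - f x) \<le> (\<bar>C\<bar> + 1) * (y - x) powr \<alpha>" if "x \<le> y" for x y
  proof (cases "x = y")
    case False
    then have "norm (f y - f x) \<le> C * (y - x) powr \<alpha>"
      using C[of y x] that by (simp add: field_simps)
    also have "\<dots> \<le> (\<bar>C\<bar> + 1) * (y - x) powr \<alpha>"
      by (intro mult_right_mono) auto
    finally show ?thesis .
  qed simp
  then show thesis
    by (intro that[of "\<bar>C\<bar> + 1"]) auto
qed

text \<open>In the squared Hoelder bound one power of y - x becomes the increment of a linear
  \<open>G\<close>; \<alpha> > 1/2 keeps the remaining exponent 2 \<alpha> - 1 positive.\<close>

lemma modulus_bound_holder:
  assumes "f \<in> holder_2pi \<alpha>" "1/2 < \<alpha>"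
  shows "\<exists>\<beta>>0. \<exists>G. modulus_bound \<beta> G f"
proof -
  obtain C where C: "C > 0" "\<And>x y. x \<le> y \<Longrightarrow> norm (f y - f x) \<le> C * (y - x) powr \<alpha>"
    using holder_2pi_bound[OF assms(1)] by blast
  have "modulus_bound (2 * \<alpha> - 1) (\<lambda>t. C\<^sup>2 * t) f"
    unfolding modulus_bound_def
  proof (intro conjI allI impI)
    show "mono_on {0..2 * pi} (\<lambda>t. C\<^sup>2 * t)"
      by (intro mono_onI mult_left_mono) auto
    fix x y :: real assume "x \<le> y"
    have "(norm (f y - f x))\<^sup>2 \<le> (C * (y - x) powr \<alpha>)\<^sup>2"
      using C(2)[OF \<open>x \<le> y\<close>] by (intro power_mono) auto
    also have "\<dots> = (y - x) powr (2 * \<alpha> - 1) * (C\<^sup>2 * y - C\<^sup>2 * x)"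
    proof (cases "x = y")
      case False
      have "((y - x) powr \<alpha>)\<^sup>2 = (y - x) powr (2 * \<alpha> - 1 + 1)"
        using powr_power[of "y - x" \<alpha> 2] False by (simp add: mult.commute)
      also have "\<dots> = (y - x) powr (2 * \<alpha> - 1) * (y - x)"
        using False \<open>x \<le> y\<close> by (subst powr_add) simp
      finally have sq: "((y - x) powr \<alpha>)\<^sup>2 = (y - x) powr (2 * \<alpha> - 1) * (y - x)" .
      show ?thesis
        unfolding power_mult_distrib sq by (simp add: algebra_simps)
    qed simp
    finally show "(norm (f y - f x))\<^sup>2 \<le> (y - x) powr (2 * \<alpha> - 1) * (C\<^sup>2 * y - C\<^sup>2 * x)" .
  qed
  then show ?thesis
    using assms(2) by (intro exI[of _ "2 * \<alpha> - 1"]) auto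
qed

text \<open>\<open>V t\<close> is the supremum of the variation sums over [l, t]. A partition of
  [l, x], extended by the step from x to y, is a partition of [l, y].\<close>

lemma bounded_variation_dominated:
  fixes f :: "real \<Rightarrow> complex"
  assumes "bounded_variation_on l u f"
  obtains V where "\<And>x y. l \<le> x \<Longrightarrow> x \<le> y \<Longrightarrow> y \<le> u \<Longrightarrow> norm (f y - f x) \<le> V y - V x"
proof -
  define S where "S = (\<lambda>t. {\<Sum>i<(n::nat). norm (f (x (Suc i)) - f (x i)) | n x. mono x \<and> range x \<subseteq> {l..t}})"
  obtain B where B: "\<And>(n::nat) x. mono x \<Longrightarrow> range x \<subseteq> {l..u} \<Longrightarrow>
      (\<Sum>i<n. norm (f (x (Suc i)) - f (x i))) \<le> B"
    using assms unfolding bounded_variation_on_def by blast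
  have bdd: "bdd_above (S t)" if "t \<le> u" for t
  proof (rule bdd_aboveI)
    fix s assume "s \<in> S t"
    then obtain n :: nat and x :: "nat \<Rightarrow> real" where
      "s = (\<Sum>i<n. norm (f (x (Suc i)) - f (x i)))" "mono x" "range x \<subseteq> {l..t}"
      unfolding S_def by blast
    moreover have "{l..t} \<subseteq> {l..u}"
      using that by auto
    ultimately show "s \<le> B"
      using B by (meson subset_trans)
  qed
  have "norm (f y - f x) \<le> Sup (S y) - Sup (S x)" if xy: "l \<le> x" "x \<le> y" "y \<le> u" for x y
  proof -
    have "Sup (S x) \<le> Sup (S y) - norm (f y - f x)"
    proof (rule cSup_least)
      show "S x \<noteq> {}"
        using xy unfolding S_def by (auto intro!: exI[of _ "\<lambda>_. x"] simp: monoI)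
      fix s assume "s \<in> S x"
      then obtain n :: nat and z :: "nat \<Rightarrow> real" where
        z: "s = (\<Sum>i<n. norm (f (z (Suc i)) - f (z i)))" "mono z" "range z \<subseteq> {l..x}"
        unfolding S_def by blast
      \<comment> \<open>A partition is an infinite monotone sequence of which only the first
        \<open>n\<close> increments count, so \<open>z\<close> may be cut off after
        \<open>z n\<close> and continued by x and then constantly by y. The increment from
        \<open>z n\<close> to x is dropped in the end.\<close>
      define z' where "z' = (\<lambda>i. if i \<le> n then z i else if i = Suc n then x else y)"
      have zx: "l \<le> z i" "z i \<le> x" for i
        using z(3) by (auto simp: image_subset_iff)
      have "mono z'"
        using z(2) zx xy unfolding z'_def by (auto intro!: monoI simp: monoD order_trans[OF zx(2)])
      moreover have "range z' \<subseteq> {l..y}"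
        using zx xy order_trans[OF zx(2) xy(2)] unfolding z'_def by auto
      ultimately have "(\<Sum>i<Suc (Suc n). norm (f (z' (Suc i)) - f (z' i))) \<in> S y"
        unfolding S_def by blast
      then have "(\<Sum>i<Suc (Suc n). norm (f (z' (Suc i)) - f (z' i))) \<le> Sup (S y)"
        using bdd[OF xy(3)] by (rule cSup_upper)
      moreover have "(\<Sum>i<n. norm (f (z' (Suc i)) - f (z' i))) = s"
        unfolding z(1) by (rule sum.cong) (auto simp: z'_def)
      moreover have "norm (f (z' (Suc (Suc n))) - f (z' (Suc n))) = norm (f y - f x)"
        by (simp add: z'_def)
      ultimately show "s \<le> Sup (S y) - norm (f y - f x)"
        using norm_ge_zero[of "f (z' (Suc n)) - f (z' n)"] unfolding sum.lessThan_Suc by linarith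
    qed
    then show ?thesis
      by simp
  qed
  then show thesis
    by (rule that)
qed

text \<open>One factor of the squared increment is estimated by the Hoelder bound, the other by the
  variation, so the full exponent \<alpha> survives.\<close>

lemma modulus_bound_bounded_variation:
  assumes "f \<in> holder_2pi \<alpha>" "0 < \<alpha>" "bounded_variation_on 0 (2 * pi) f"
  shows "\<exists>\<beta>>0. \<exists>G. modulus_bound \<beta> G f"
proof -
  obtain C where C: "C > 0" "\<And>x y. x \<le> y \<Longrightarrow> norm (f y - f x) \<le> C * (y - x) powr \<alpha>"
    using holder_2pi_bound[OF assms(1)] by blast
  obtain V where V: "\<And>x y. 0 \<le> x \<Longrightarrow> x \<le> y \<Longrightarrow> y \<le> 2 * pi \<Longrightarrow> norm (f y - f x) \<le> V y - V x"
    using bounded_variation_dominated[OF assms(3)] by blast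
  have "modulus_bound \<alpha> (\<lambda>t. C * V t) f"
    unfolding modulus_bound_def
  proof (intro conjI allI impI)
    show "mono_on {0..2 * pi} (\<lambda>t. C * V t)"
    proof (rule mono_onI)
      fix r s assume rs: "r \<in> {0..2 * pi}" "s \<in> {0..2 * pi}" "r \<le> s"
      then have "0 \<le> V s - V r"
        using V[of r s] by (intro order_trans[OF norm_ge_zero]) auto
      then show "C * V r \<le> C * V s"
        using C(1) by simp
    qed
    fix x y :: real assume xy: "0 \<le> x" "x \<le> y" "y \<le> 2 * pi"
    have "(norm (f y - f x))\<^sup>2 \<le> (C * (y - x) powr \<alpha>) * (V y - V x)"
      unfolding power2_eq_square using C V xy by (intro mult_mono) auto
    then show "(norm (f y - f x))\<^sup>2 \<le> (y - x) powr \<alpha> * (C * V y - C * V x)"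
      by (simp add: algebra_simps)
  qed
  then show ?thesis
    using assms(2) by blast
qed

text \<open>Cauchy-Schwarz for the gauge integral, obtained by integrating 2 c |g| \<le> c^2 +
  |g|^2. The choice c = |D| / (y - x) is the optimal one.\<close>

lemma norm_integral_squared_le:
  fixes g :: "real \<Rightarrow> complex"
  assumes g: "(g has_integral D) {x..y}" and g2: "((\<lambda>t. (norm (g t))\<^sup>2) has_integral I) {x..y}"
    and "x \<le> y"
  shows "(norm D)\<^sup>2 \<le> (y - x) * I"
proof -
  have I: "0 \<le> I"
    by (rule has_integral_nonneg[OF g2]) simp
  show ?thesis
  proof (cases "x = y \<or> D = 0")
    case True
    then have "D = 0"
      using g has_integral_unique[of g D "{x..x}" 0] by (auto simp: has_integral_refl)
    then show ?thesis
      using I \<open>x \<le> y\<close> by simp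
  next
    case False
    define c where "c = norm D / (y - x)"
    have pos: "y - x > 0" "norm D > 0" and c: "c > 0"
      using False \<open>x \<le> y\<close> by (auto simp: c_def)
    have rhs: "((\<lambda>t. c\<^sup>2 + (norm (g t))\<^sup>2) has_integral (c\<^sup>2 * (y - x) + I)) {x..y}"
      using has_integral_add[OF has_integral_const_real[of "c\<^sup>2" x y] g2] \<open>x \<le> y\<close>
      by (simp add: mult.commute)
    have lhs: "((\<lambda>t. complex_of_real (2 * c) * g t) has_integral (of_real (2 * c) * D)) {x..y}"
      by (rule has_integral_mult_right[OF g])
    have "norm (of_real (2 * c) * D) \<le> c\<^sup>2 * (y - x) + I"
    proof (subst integral_unique[OF lhs, symmetric], subst integral_unique[OF rhs, symmetric],
        rule integral_norm_bound_integral)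
      show "norm (complex_of_real (2 * c) * g t) \<le> c\<^sup>2 + (norm (g t))\<^sup>2" for t
        using sum_squares_bound[of c "norm (g t)"] c by (simp add: norm_mult)
    qed (use lhs rhs in auto)
    then have "2 * c * norm D \<le> c\<^sup>2 * (y - x) + I"
      using c by (simp add: norm_mult)
    then have "(norm D)\<^sup>2 / (y - x) \<le> I"
      using pos unfolding c_def by (simp add: power2_eq_square)
    then show ?thesis
      using pos by (simp add: field_simps)
  qed
qed

text \<open>The increment over [x, y] is the integral of the almost everywhere derivative;
  Cauchy-Schwarz gives the exponent \<beta> = 1.\<close>

lemma modulus_bound_abs_continuous:
  assumes ac: "abs_continuous_on 0 (2 * pi) f" and L2: "L2_derivative_on 0 (2 * pi) f"
  shows "\<exists>\<beta>>0. \<exists>G. modulus_bound \<beta> G f"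
proof -
  obtain g where g: "AE t in lebesgue_on {0..2 * pi}. (f has_vector_derivative g t) (at t)"
    "integrable (lebesgue_on {0..2 * pi}) (\<lambda>t. (norm (g t))\<^sup>2)"
    using L2 unfolding L2_derivative_on_def by blast
  have "AE t in lebesgue. t \<in> {0..2 * pi} \<longrightarrow> (f has_vector_derivative g t) (at t)"
    using g(1) by (subst (asm) AE_restrict_space_iff) auto
  then obtain N where N: "\<And>t. t \<in> space lebesgue - N \<Longrightarrow>
      t \<in> {0..2 * pi} \<longrightarrow> (f has_vector_derivative g t) (at t)" "N \<in> null_sets lebesgue"
    by (rule AE_E3) blast
  have negl: "negligible N"
    using N(2) negligible_iff_null_sets by blast
  have int: "(\<lambda>t. (norm (g t))\<^sup>2) integrable_on {0..2 * pi}"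
    by (rule integrable_on_lebesgue_on[OF g(2)]) auto
  define G where "G = (\<lambda>t. integral {0..t} (\<lambda>t. (norm (g t))\<^sup>2))"
  have int': "(\<lambda>t. (norm (g t))\<^sup>2) integrable_on {x..y}" if "0 \<le> x" "y \<le> 2 * pi" for x y
    by (rule integrable_on_subinterval[OF int]) (use that in auto)
  have Gdiff: "G y - G x = integral {x..y} (\<lambda>t. (norm (g t))\<^sup>2)" if "0 \<le> x" "x \<le> y" "y \<le> 2 * pi" for x y
    using Henstock_Kurzweil_Integration.integral_combine[OF that(1,2) int'[OF order_refl that(3)]]
    unfolding G_def by simp
  have "modulus_bound 1 G f"
    unfolding modulus_bound_def
  proof (intro conjI allI impI)
    show "mono_on {0..2 * pi} G"
    proof (rule mono_onI)
      fix r s assume "r \<in> {0..2 * pi}" "s \<in> {0..2 * pi}" "r \<le> s"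
      then have "G s - G r \<ge> 0"
        by (subst Gdiff) (auto intro!: integral_nonneg int')
      then show "G r \<le> G s"
        by simp
    qed
    fix x y :: real assume xy: "0 \<le> x" "x \<le> y" "y \<le> 2 * pi"
    have "(g has_integral (f y - f x)) {x..y}"
    proof (rule abs_continuous_on_has_integral[OF _ xy(2) negl])
      show "abs_continuous_on x y f"
        by (rule abs_continuous_on_subinterval[OF ac xy(1,3)])
      show "(f has_vector_derivative g t) (at t)" if "t \<in> {x..y} - N" for t
        using N(1)[of t] that xy by auto
    qed
    then have "(norm (f y - f x))\<^sup>2 \<le> (y - x) * (G y - G x)"
      unfolding Gdiff[OF xy]
      by (rule norm_integral_squared_le[OF _ integrable_integral[OF int'] xy(2)]) (use xy in auto)
    then show "(norm (f y - f x))\<^sup>2 \<le> (y - x) powr 1 * (G y - G x)"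
      using xy by simp
  qed
  then show ?thesis
    using zero_less_one by blast
qed

subsection \<open>Fourier coefficients\<close>

lemma continuous_integrable_on: "continuous_on UNIV f \<Longrightarrow> f integrable_on {a..b}"
  for f :: "real \<Rightarrow> complex"
  by (rule integrable_continuous_real) (rule continuous_on_subset, auto)

lemma periodic_add_int:
  assumes "periodic f"
  shows "f (t + 2 * pi * of_int k) = f t"
proof -
  have nat: "f (t + 2 * pi * of_nat n) = f t" for t n
  proof (induction n)
    case (Suc n)
    have "f (t + 2 * pi * of_nat (Suc n)) = f ((t + 2 * pi * of_nat n) + 2 * pi)"
      by (simp add: algebra_simps)
    then show ?case
      using assms Suc unfolding periodic_def by simp
  qed simp
  show ?thesis
  proof (cases "k \<ge> 0")
    case True
    then show ?thesis
      using nat[of t "nat k"] by simp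
  next
    case False
    then show ?thesis
      using nat[of "t + 2 * pi * of_int k" "nat (- k)"] by simp
  qed
qed

lemma periodic_reduce:
  assumes "periodic f"
  obtains s where "0 \<le> s" "s \<le> 2 * pi" "f t = f s"
proof -
  define k where "k = \<lfloor>t / (2 * pi)\<rfloor>"
  have "of_int k \<le> t / (2 * pi)" "t / (2 * pi) \<le> of_int k + 1"
    unfolding k_def by linarith+
  then have "2 * pi * of_int k \<le> t" "t \<le> 2 * pi * of_int k + 2 * pi"
    by (simp_all add: field_simps)
  then show thesis
    using periodic_add_int[OF assms, of t "- k"]
    by (intro that[of "t - 2 * pi * of_int k"]) auto
qed

lemma integral_cis:
  "integral {0..2 * pi} (\<lambda>t. cis (of_int k * t)) = (if k = 0 then 2 * pi else 0)"
proof (cases "k = 0")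
  case False
  have "((\<lambda>t. cis (of_int k * t)) has_integral
      (exp (\<i> * of_int k * of_real (2 * pi)) / (\<i> * of_int k) - exp (\<i> * of_int k * of_real 0) / (\<i> * of_int k))) {0..2 * pi}"
  proof (rule fundamental_theorem_of_calculus)
    fix x
    have "((\<lambda>z. exp (\<i> * of_int k * z) / (\<i> * of_int k)) has_field_derivative cis (of_int k * x))
        (at (of_real x))"
      using False by (auto intro!: derivative_eq_intros simp: cis_conv_exp mult_ac)
    then show "((\<lambda>x. exp (\<i> * of_int k * complex_of_real x) / (\<i> * of_int k)) has_vector_derivative
        cis (of_int k * x)) (at x within {0..2 * pi})"
      by (rule has_vector_derivative_real_field)
  qed simp
  moreover have "exp (\<i> * of_int k * of_real (2 * pi)) = 1"
    using exp_integer_2pi[of "of_int k"] by (simp add: mult_ac)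
  ultimately show ?thesis
    using False by (simp add: integral_unique)
qed (simp add: scaleR_conv_of_real)

lemma fourier_coeff_cis:
  "fourier_coeff (\<lambda>t. c * cis (of_int m * t)) k = (if m = k then c else 0)"
proof -
  have "(\<lambda>t. c * cis (of_int m * t) * cis (- (of_int k * t))) = (\<lambda>t. c * cis (of_int (m - k) * t))"
    by (simp add: mult.assoc cis_mult algebra_simps)
  then show ?thesis
    unfolding fourier_coeff_def by (simp add: integral_cis del: of_int_diff)
qed

lemma fourier_coeff_diff:
  assumes "continuous_on UNIV f" "continuous_on UNIV g"
  shows "fourier_coeff (\<lambda>t. f t - g t) k = fourier_coeff f k - fourier_coeff g k"
proof -
  have "integral {0..2 * pi} (\<lambda>t. f t * cis (- (of_int k * t)) - g t * cis (- (of_int k * t)))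
     = integral {0..2 * pi} (\<lambda>t. f t * cis (- (of_int k * t)))
      - integral {0..2 * pi} (\<lambda>t. g t * cis (- (of_int k * t)))"
    by (intro integral_diff continuous_integrable_on continuous_intros assms)
  then show ?thesis
    unfolding fourier_coeff_def by (simp add: left_diff_distrib diff_divide_distrib)
qed

lemma fourier_coeff_sum:
  assumes "finite S" "\<And>x. x \<in> S \<Longrightarrow> continuous_on UNIV (f x)"
  shows "fourier_coeff (\<lambda>t. \<Sum>x\<in>S. f x t) k = (\<Sum>x\<in>S. fourier_coeff (f x) k)"
proof -
  have "integral {0..2 * pi} (\<lambda>t. \<Sum>x\<in>S. f x t * cis (- (of_int k * t)))
     = (\<Sum>x\<in>S. integral {0..2 * pi} (\<lambda>t. f x t * cis (- (of_int k * t))))"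
    using assms by (intro integral_sum continuous_integrable_on continuous_intros) auto
  then show ?thesis
    unfolding fourier_coeff_def by (simp add: sum_distrib_right sum_divide_distrib)
qed

lemma norm_fourier_coeff_le:
  assumes "continuous_on UNIV f" "\<And>t. norm (f t) \<le> M"
  shows "norm (fourier_coeff f k) \<le> M"
proof -
  have "norm (integral {0..2 * pi} (\<lambda>t. f t * cis (- (of_int k * t)))) \<le> integral {0..2 * pi} (\<lambda>t. M)"
    using assms by (intro integral_norm_bound_integral continuous_integrable_on continuous_intros)
      (auto simp: norm_mult)
  then show ?thesis
    by (simp add: fourier_coeff_def norm_divide field_simps)
qed

lemma integral_periodic_shift:
  fixes f :: "real \<Rightarrow> complex"
  assumes "continuous_on UNIV f" "periodic f" "0 \<le> h" "h \<le> 2 * pi"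
  shows "integral {0..2 * pi} (\<lambda>t. f (t + h)) = integral {0..2 * pi} f"
proof -
  note int = continuous_integrable_on[OF assms(1)]
  have shift: "integral {a..b} (\<lambda>t. f (t + c)) = integral {a + c..b + c} f" for a b c
    using integral_shift_Icc_real[of a b f c] by (simp add: o_def add.commute)
  have "integral {0..2 * pi} (\<lambda>t. f (t + h)) = integral {h..2 * pi + h} f"
    using shift[of 0 "2 * pi" h] by simp
  also have "\<dots> = integral {h..2 * pi} f + integral {2 * pi..2 * pi + h} f"
    using assms(3,4) int by (intro Henstock_Kurzweil_Integration.integral_combine[symmetric]) auto
  also have "integral {2 * pi..2 * pi + h} f = integral {0..h} (\<lambda>t. f (t + 2 * pi))"
    using shift[of 0 h "2 * pi"] by (simp add: add.commute)
  also have "\<dots> = integral {0..h} f"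
    using assms(2) unfolding periodic_def by simp
  also have "integral {h..2 * pi} f + integral {0..h} f = integral {0..2 * pi} f"
    using Henstock_Kurzweil_Integration.integral_combine[OF assms(3,4) int] by (simp add: add.commute)
  finally show ?thesis .
qed

lemma fourier_coeff_shift:
  assumes "continuous_on UNIV f" "periodic f" "0 \<le> h" "h \<le> 2 * pi"
  shows "fourier_coeff (\<lambda>t. f (t + h)) k = cis (of_int k * h) * fourier_coeff f k"
proof -
  define F where "F = (\<lambda>t. f t * cis (- (of_int k * t)))"
  have per: "periodic F"
    unfolding periodic_def
  proof
    fix t
    have "cis (- (of_int k * (t + 2 * pi))) = cis (- (of_int k * t)) * cis (2 * pi * of_int (- k))"
      by (simp add: cis_mult algebra_simps)
    also have "cis (2 * pi * of_int (- k)) = 1"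
      by (rule cis_multiple_2pi) simp
    finally show "F (t + 2 * pi) = F t"
      using assms(2) by (simp add: F_def periodic_def)
  qed
  have "integral {0..2 * pi} (\<lambda>t. f (t + h) * cis (- (of_int k * t)))
      = integral {0..2 * pi} (\<lambda>t. cis (of_int k * h) * F (t + h))"
    by (rule arg_cong[where f = "integral _"])
      (auto simp: F_def fun_eq_iff cis_mult mult.left_commute algebra_simps)
  also have "\<dots> = cis (of_int k * h) * integral {0..2 * pi} F"
    using integral_periodic_shift[OF _ per assms(3,4)] assms(1)
    by (simp add: F_def continuous_intros)
  finally show ?thesis
    by (simp add: fourier_coeff_def F_def)
qed

text \<open>The kernel is the squared modulus of (1 + e^(i(t - s)))^n, and the binomial theorem
  expands both conjugate factors. The terms are grouped so that integrals against the kernel become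
  Toeplitz forms.\<close>

lemma kernel_expansion:
  "complex_of_real ((2 + 2 * cos (t - s)) ^ n) =
    (\<Sum>i\<le>n. \<Sum>j\<le>n. cnj (of_nat (n choose i) * cis (of_nat i * s)) * (of_nat (n choose j) * cis (of_nat j * s))
       * cis (- (of_int (int j - int i) * t)))"
proof -
  have pow: "(1 + cis x) ^ n = (\<Sum>i\<le>n. of_nat (n choose i) * cis (of_nat i * x))" for x
    using binomial_ring[of "cis x" 1 n] unfolding Complex.DeMoivre[symmetric] by (simp add: add.commute)
  have "complex_of_real (2 + 2 * cos (t - s)) = (1 + cis (t - s)) * (1 + cis (s - t))"
    using sin_cos_squared_add[of "t - s"] cos_minus[of "t - s"] sin_minus[of "t - s"]
    by (auto simp: complex_eq_iff algebra_simps power2_eq_square)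
  then have "complex_of_real ((2 + 2 * cos (t - s)) ^ n) = (1 + cis (t - s)) ^ n * (1 + cis (s - t)) ^ n"
    by (simp add: power_mult_distrib)
  also have "\<dots> = (\<Sum>i\<le>n. \<Sum>j\<le>n. (of_nat (n choose i) * cis (of_nat i * (t - s)))
      * (of_nat (n choose j) * cis (of_nat j * (s - t))))"
    unfolding pow by (rule sum_product)
  also have "\<dots> = (\<Sum>i\<le>n. \<Sum>j\<le>n. cnj (of_nat (n choose i) * cis (of_nat i * s)) * (of_nat (n choose j) * cis (of_nat j * s))
       * cis (- (of_int (int j - int i) * t)))"
  proof (intro sum.cong refl)
    fix i j :: nat
    have "cis (of_nat i * (t - s)) * cis (of_nat j * (s - t))
        = cis (- (of_nat i * s)) * cis (of_nat j * s) * cis (- (of_int (int j - int i) * t))"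
      by (simp add: cis_mult algebra_simps)
    then show "(of_nat (n choose i) * cis (of_nat i * (t - s))) * (of_nat (n choose j) * cis (of_nat j * (s - t)))
      = cnj (of_nat (n choose i) * cis (of_nat i * s)) * (of_nat (n choose j) * cis (of_nat j * s))
       * cis (- (of_int (int j - int i) * t))"
      by (simp add: cis_cnj mult_ac)
  qed
  finally show ?thesis .
qed

text \<open>The bridge between functions and matrices: the double sum is the form of a finite
  Toeplitz matrix of \<open>f\<close> at the vector of binomial coefficients modulated by e^(ijs).
  The modulation moves the peak of the kernel to s.\<close>

lemma integral_kernel:
  assumes "continuous_on UNIV f"
  defines "c \<equiv> \<lambda>s n j. of_nat (n choose j) * cis (of_nat j * s)"
  shows "integral {0..2 * pi} (\<lambda>t. f t * of_real ((2 + 2 * cos (t - s)) ^ n)) =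
     2 * pi * (\<Sum>i\<le>n. \<Sum>j\<le>n. cnj (c s n i) * c s n j * fourier_coeff f (int j - int i))"
proof -
  have "integral {0..2 * pi} (\<lambda>t. f t * of_real ((2 + 2 * cos (t - s)) ^ n))
      = integral {0..2 * pi} (\<lambda>t. \<Sum>i\<le>n. \<Sum>j\<le>n. cnj (c s n i) * c s n j * (f t * cis (- (of_int (int j - int i) * t))))"
    unfolding kernel_expansion c_def
    by (simp add: sum_distrib_left mult_ac)
  also have "\<dots> = (\<Sum>i\<le>n. \<Sum>j\<le>n. cnj (c s n i) * c s n j * integral {0..2 * pi} (\<lambda>t. f t * cis (- (of_int (int j - int i) * t))))"
    by (simp add: integral_sum continuous_integrable_on continuous_intros assms(1) del: of_int_diff)
  also have "\<dots> = 2 * pi * (\<Sum>i\<le>n. \<Sum>j\<le>n. cnj (c s n i) * c s n j * fourier_coeff f (int j - int i))"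
    by (simp add: fourier_coeff_def sum_distrib_left mult_ac del: of_int_diff)
  finally show ?thesis .
qed

text \<open>The kernels \<open>(2 + 2 cos (t - s))\<^sup>n\<close> concentrate at \<open>s\<close> and are trigonometric polynomials,
  so they can replace the Fejer kernels.\<close>

lemma nonneg_if_kernel_integrals_nonneg:
  fixes f :: "real \<Rightarrow> real"
  assumes cont: "continuous_on UNIV f"
    and nonneg: "\<And>n. integral {0..2 * pi} (\<lambda>t. f t * (2 + 2 * cos (t - s)) ^ n) \<ge> 0"
    and s: "0 < s" "s < 2 * pi"
  shows "f s \<ge> 0"
proof (rule ccontr)
  assume neg: "\<not> f s \<ge> 0"
  define e where "e = - f s / 2"
  have e: "e > 0"
    using neg by (simp add: e_def)
  obtain d0 where d0: "d0 > 0" "\<And>t. \<bar>t - s\<bar> < d0 \<Longrightarrow> \<bar>f t - f s\<bar> < e"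
    using cont e unfolding continuous_on_iff dist_real_def by (meson UNIV_I)
  \<comment> \<open>\<open>d\<close> is smaller than the distances of s from 0 and from 2 pi. Hence
    points of the period farther than \<open>d\<close> from s are also farther than \<open>d\<close>
    from it modulo 2 pi, where the kernel would peak again.\<close>
  define d where "d = min (d0 / 2) (min s (2 * pi - s) / 2)"
  have d: "d > 0" "d < d0" "d < s" "d < 2 * pi - s" "d < pi"
    using d0 s by (auto simp: d_def min_def)
  have near: "f t \<le> - e" if "\<bar>t - s\<bar> \<le> d" for t
    using d0(2)[of t] that d unfolding e_def by (simp add: abs_if split: if_splits)
  obtain M where M: "M > 0" "\<And>t. t \<in> {0..2 * pi} \<Longrightarrow> \<bar>f t\<bar> \<le> M"
  proof -
    have "compact (f ` {0..2 * pi})"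
      by (intro compact_continuous_image continuous_on_subset[OF cont]) auto
    then show thesis
      using that unfolding bounded_pos[symmetric]
      by (metis (no_types, lifting) bounded_pos compact_imp_bounded image_eqI real_norm_def)
  qed
  \<comment> \<open>\<open>q\<close> bounds the base of the kernel from above beyond distance
    \<open>d\<close>, \<open>Q\<close> bounds it from below up to distance d / 2. As q < Q, the
    negative contribution near s outweighs the rest for large \<open>n\<close>.\<close>
  define q Q where "q = 2 + 2 * cos d" and "Q = 2 + 2 * cos (d / 2)"
  have qQ: "0 \<le> q" "q < Q"
    using d cos_monotone_0_pi[of "d / 2" d] cos_ge_minus_one[of d] unfolding q_def Q_def by linarith+
  have far_le: "cos (t - s) \<le> cos d" if "t \<in> {0..2 * pi}" "\<bar>t - s\<bar> > d" for t
  proof (cases "\<bar>t - s\<bar> \<le> pi")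
    case True
    then show ?thesis
      using cos_monotone_0_pi_le[of d "\<bar>t - s\<bar>"] that d by simp
  next
    case False
    have "cos (t - s) = cos (2 * pi - \<bar>t - s\<bar>)"
      by (simp add: cos_diff)
    also have "\<dots> \<le> cos d"
      using that d s False by (intro cos_monotone_0_pi_le) (auto simp: abs_if split: if_splits)
    finally show ?thesis .
  qed
  have bound: "f t * (2 + 2 * cos (t - s)) ^ n \<le> M * q ^ n - (if \<bar>t - s\<bar> \<le> d / 2 then e * Q ^ n else 0)"
    if t: "t \<in> {0..2 * pi}" for t n
  proof -
    have w: "0 \<le> 2 + 2 * cos (t - s)"
      using cos_ge_minus_one[of "t - s"] by linarith
    consider "\<bar>t - s\<bar> \<le> d / 2" | "\<bar>t - s\<bar> > d / 2" "\<bar>t - s\<bar> \<le> d" | "\<bar>t - s\<bar> > d"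
      by linarith
    then show ?thesis
    proof cases
      case 1
      have "Q \<le> 2 + 2 * cos (t - s)"
        using 1 d cos_monotone_0_pi_le[of "\<bar>t - s\<bar>" "d / 2"] by (simp add: Q_def)
      then have "Q ^ n \<le> (2 + 2 * cos (t - s)) ^ n"
        using qQ by (intro power_mono) auto
      then have "e * Q ^ n \<le> (- f t) * (2 + 2 * cos (t - s)) ^ n"
        using near[of t] 1 d e qQ by (intro mult_mono) auto
      moreover have "0 \<le> M * q ^ n"
        using M qQ by simp
      ultimately show ?thesis
        using 1 by simp
    next
      case 2
      have "f t * (2 + 2 * cos (t - s)) ^ n \<le> 0"
        using near[OF 2(2)] e w by (intro mult_nonpos_nonneg) auto
      also have "0 \<le> M * q ^ n"
        using M qQ by simp
      finally show ?thesis
        using 2 by simp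
    next
      case 3
      have "f t * (2 + 2 * cos (t - s)) ^ n \<le> M * q ^ n"
        using far_le[OF t 3] M(1) M(2)[OF t] w by (intro mult_mono power_mono) (auto simp: q_def)
      then show ?thesis
        using 3 d by simp
    qed
  qed
  have "0 \<le> 2 * pi * M * q ^ n - e * d * Q ^ n" for n
  proof -
    have "0 \<le> integral {0..2 * pi} (\<lambda>t. f t * (2 + 2 * cos (t - s)) ^ n)"
      by (rule nonneg)
    also have "\<dots> \<le> 2 * pi * M * q ^ n - e * d * Q ^ n"
    proof (rule has_integral_le)
      show "((\<lambda>t. f t * (2 + 2 * cos (t - s)) ^ n) has_integral
          integral {0..2 * pi} (\<lambda>t. f t * (2 + 2 * cos (t - s)) ^ n)) {0..2 * pi}"
        by (intro integrable_integral integrable_continuous_real continuous_intros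
            continuous_on_subset[OF cont]) auto
      have "((\<lambda>t. e * Q ^ n) has_integral (e * Q ^ n * d)) {s - d / 2..s + d / 2}"
        using has_integral_const_real[of "e * Q ^ n" "s - d / 2" "s + d / 2"] d
        by (simp add: mult.commute)
      then have "((\<lambda>t. if t \<in> {s - d / 2..s + d / 2} then e * Q ^ n else 0) has_integral
          (e * Q ^ n * d)) {0..2 * pi}"
        using d by (subst has_integral_restrict) auto
      moreover have "(\<lambda>t. if t \<in> {s - d / 2..s + d / 2} then e * Q ^ n else 0)
          = (\<lambda>t. if \<bar>t - s\<bar> \<le> d / 2 then e * Q ^ n else 0)"
        by (auto simp: fun_eq_iff abs_if)
      ultimately have "((\<lambda>t. if \<bar>t - s\<bar> \<le> d / 2 then e * Q ^ n else 0) has_integral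
          (e * Q ^ n * d)) {0..2 * pi}"
        by simp
      from has_integral_diff[OF has_integral_const_real[of "M * q ^ n" 0 "2 * pi"] this]
      show "((\<lambda>t. M * q ^ n - (if \<bar>t - s\<bar> \<le> d / 2 then e * Q ^ n else 0)) has_integral
          (2 * pi * M * q ^ n - e * d * Q ^ n)) {0..2 * pi}"
        by (simp add: mult_ac)
    qed (rule bound)
    finally show ?thesis .
  qed
  then have *: "e * d \<le> 2 * pi * M * (q / Q) ^ n" for n
    using qQ by (simp add: power_divide field_simps)
  have "(\<lambda>n. 2 * pi * M * (q / Q) ^ n) \<longlonglongrightarrow> 2 * pi * M * 0"
    using qQ by (intro tendsto_intros LIMSEQ_power_zero) auto
  then have "e * d \<le> 2 * pi * M * 0"
    using * by (intro tendsto_lowerbound[of _ _ sequentially]) auto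
  then show False
    using e d by (simp add: mult_le_0_iff)
qed

text \<open>At an end point the peak of the kernel is split between both ends of the period;
  continuity takes care of these two points.\<close>

lemma nonneg_on_period:
  fixes f :: "real \<Rightarrow> real"
  assumes cont: "continuous_on UNIV f"
    and nonneg: "\<And>s n. integral {0..2 * pi} (\<lambda>t. f t * (2 + 2 * cos (t - s)) ^ n) \<ge> 0"
    and s: "s \<in> {0..2 * pi}"
  shows "f s \<ge> 0"
  by (rule continuous_ge_on_closure[of "{0<..<2 * pi}"])
    (use s continuous_on_subset[OF cont] nonneg_if_kernel_integrals_nonneg[OF cont nonneg] in auto)

text \<open>All kernel integrals of \<open>f\<close> vanish, so the nonnegativity criterion applies
  to the real and imaginary parts with both signs.\<close>

lemma fourier_coeff_unique:
  assumes f: "f \<in> C_2pi" and zero: "\<And>k. fourier_coeff f k = 0"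
  shows "f t = 0"
proof -
  have cont: "continuous_on UNIV f" and per: "periodic f"
    using f by (auto simp: C_2pi_def)
  have int0: "((\<lambda>t. f t * of_real ((2 + 2 * cos (t - s)) ^ n)) has_integral 0) {0..2 * pi}" for s n
  proof -
    have "integral {0..2 * pi} (\<lambda>t. f t * of_real ((2 + 2 * cos (t - s)) ^ n)) = 0"
      by (subst integral_kernel[OF cont]) (simp add: zero)
    moreover have "(\<lambda>t. f t * of_real ((2 + 2 * cos (t - s)) ^ n)) integrable_on {0..2 * pi}"
      by (intro continuous_integrable_on continuous_intros cont)
    ultimately show ?thesis
      by (metis integrable_integral)
  qed
  have Re0: "integral {0..2 * pi} (\<lambda>t. Re (f t) * (2 + 2 * cos (t - s)) ^ n) = 0"
    and Im0: "integral {0..2 * pi} (\<lambda>t. Im (f t) * (2 + 2 * cos (t - s)) ^ n) = 0" for s n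
    using has_integral_linear[OF int0[of s n] bounded_linear_Re]
      has_integral_linear[OF int0[of s n] bounded_linear_Im]
    by (auto simp: o_def simp flip: of_real_power intro!: integral_unique)
  have "f s = 0" if "s \<in> {0..2 * pi}" for s
  proof -
    have "Re (f s) \<ge> 0" "- Re (f s) \<ge> 0" "Im (f s) \<ge> 0" "- Im (f s) \<ge> 0"
      using nonneg_on_period[of "\<lambda>t. Re (f t)" s] nonneg_on_period[of "\<lambda>t. - Re (f t)" s]
        nonneg_on_period[of "\<lambda>t. Im (f t)" s] nonneg_on_period[of "\<lambda>t. - Im (f t)" s] that
      by (simp_all add: Re0 Im0 cont continuous_intros)
    then show ?thesis
      by (simp add: complex_eq_iff)
  qed
  then show ?thesis
    using periodic_reduce[OF per, of t] by auto
qed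

text \<open>\<open>g\<close> is the orthogonal projection of \<open>f\<close> onto the characters in
  \<open>S\<close>, and the integral of |f - g|^2 is the difference of the two sides.\<close>

lemma bessel_inequality:
  assumes cont: "continuous_on UNIV f" and S: "finite S"
  shows "2 * pi * (\<Sum>k\<in>S. (norm (fourier_coeff f k))\<^sup>2) \<le> integral {0..2 * pi} (\<lambda>t. (norm (f t))\<^sup>2)"
proof -
  define g where "g = (\<lambda>t. \<Sum>k\<in>S. fourier_coeff f k * cis (of_int k * t))"
  have contg: "continuous_on UNIV g"
    unfolding g_def by (intro continuous_intros)
  have expand: "(norm (f t - g t))\<^sup>2 = (norm (f t))\<^sup>2 - 2 * Re (f t * cnj (g t)) + Re (g t * cnj (g t))" for t
    by (simp only: cmod_power2) (simp add: algebra_simps power2_eq_square)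
  \<comment> \<open>Serves both the mixed term (u = f) and the quadratic term (u = g), since
    \<open>g\<close> has the coefficients of \<open>f\<close> on \<open>S\<close>.\<close>
  have coeff: "integral {0..2 * pi} (\<lambda>t. u t * cnj (g t))
      = 2 * pi * (\<Sum>k\<in>S. cnj (fourier_coeff f k) * fourier_coeff u k)"
    if "continuous_on UNIV u" for u
  proof -
    have "integral {0..2 * pi} (\<lambda>t. u t * cnj (g t))
        = integral {0..2 * pi} (\<lambda>t. \<Sum>k\<in>S. cnj (fourier_coeff f k) * (u t * cis (- (of_int k * t))))"
      unfolding g_def by (simp add: sum_distrib_left cis_cnj mult_ac)
    also have "\<dots> = (\<Sum>k\<in>S. cnj (fourier_coeff f k) * integral {0..2 * pi} (\<lambda>t. u t * cis (- (of_int k * t))))"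
      using S that by (simp add: integral_sum continuous_integrable_on continuous_intros)
    finally show ?thesis
      by (simp add: fourier_coeff_def sum_distrib_left mult_ac)
  qed
  have gcoeff: "fourier_coeff g k = fourier_coeff f k" if "k \<in> S" for k
    using that S unfolding g_def
    by (subst fourier_coeff_sum) (auto intro!: continuous_intros simp: fourier_coeff_cis)
  define B where "B = (\<Sum>k\<in>S. (norm (fourier_coeff f k))\<^sup>2)"
  have B: "(\<Sum>k\<in>S. cnj (fourier_coeff f k) * fourier_coeff f k) = of_real B"
    unfolding B_def by (simp add: complex_norm_square mult.commute del: of_real_power)
  have int: "(\<lambda>t. u t) integrable_on {0..2 * pi}" if "continuous_on UNIV u" for u :: "real \<Rightarrow> real"
    by (rule integrable_continuous_real[OF continuous_on_subset[OF that]]) simp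
  have Re: "integral {0..2 * pi} (\<lambda>t. Re (u t)) = Re (integral {0..2 * pi} u)"
    if "continuous_on UNIV u" for u
    using integral_linear[OF continuous_integrable_on[OF that] bounded_linear_Re] by (simp add: o_def)
  have fg: "integral {0..2 * pi} (\<lambda>t. Re (f t * cnj (g t))) = 2 * pi * B"
    by (subst Re) (auto intro!: continuous_intros cont contg simp: coeff cont B)
  have gg: "integral {0..2 * pi} (\<lambda>t. Re (g t * cnj (g t))) = 2 * pi * B"
    by (subst Re) (auto intro!: continuous_intros contg simp: coeff contg gcoeff B)
  have "0 \<le> integral {0..2 * pi} (\<lambda>t. (norm (f t - g t))\<^sup>2)"
    by (intro integral_nonneg int continuous_intros cont contg) auto
  also have "\<dots> = integral {0..2 * pi} (\<lambda>t. (norm (f t))\<^sup>2) - 2 * (2 * pi * B) + 2 * pi * B"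
    unfolding expand
    by (simp add: Henstock_Kurzweil_Integration.integral_add Henstock_Kurzweil_Integration.integral_diff
        integrable_diff int continuous_intros cont contg fg gg del: times_complex.simps)
  finally show ?thesis
    by (simp add: B_def)
qed

text \<open>Membership in \<open>wiener\<close> also asks that the Fourier series represent
  \<open>f\<close>. The series converges uniformly to a continuous periodic function with the same
  coefficients, and uniqueness identifies it with \<open>f\<close>.\<close>

lemma wiener_if_summable:
  assumes f: "f \<in> C_2pi" and summ: "(\<lambda>k. norm (fourier_coeff f k)) summable_on UNIV"
  shows "f \<in> wiener"
proof -
  have cont: "continuous_on UNIV f" and per: "periodic f"
    using f by (auto simp: C_2pi_def)
  define e where "e = (\<lambda>k t. fourier_coeff f k * cis (of_int k * t))"
  define g where "g = (\<lambda>t. \<Sum>\<^sub>\<infinity>k. e k t)"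
  have unif: "uniform_limit UNIV (\<lambda>X t. \<Sum>k\<in>X. e k t) g (finite_subsets_at_top UNIV)"
    unfolding g_def by (rule Weierstrass_m_test_general[OF _ summ]) (simp add: e_def norm_mult)
  have sums: "((\<lambda>k. e k t) has_sum g t) UNIV" for t
    using tendsto_uniform_limitI[OF unif, of t] by (simp add: has_sum_def)
  have conte: "continuous_on UNIV (\<lambda>t. \<Sum>k\<in>X. e k t)" for X
    unfolding e_def by (intro continuous_intros)
  have contg: "continuous_on UNIV g"
    by (rule uniform_limit_theorem[OF _ unif]) (auto intro!: always_eventually conte)
  have perg: "periodic g"
  proof -
    have "e k (t + 2 * pi) = e k t" for k t
    proof -
      have "cis (of_int k * (t + 2 * pi)) = cis (of_int k * t) * cis (2 * pi * of_int k)"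
        by (simp add: cis_mult algebra_simps)
      also have "cis (2 * pi * of_int k) = 1"
        by (rule cis_multiple_2pi) simp
      finally show ?thesis
        by (simp add: e_def)
    qed
    then show ?thesis
      by (simp add: periodic_def g_def)
  qed
  have coeffg: "fourier_coeff g m = fourier_coeff f m" for m
  proof -
    have "((\<lambda>X. fourier_coeff (\<lambda>t. \<Sum>k\<in>X. e k t) m) \<longlongrightarrow> fourier_coeff g m) (finite_subsets_at_top UNIV)"
    proof (rule tendstoI)
      fix \<epsilon> :: real assume \<epsilon>: "\<epsilon> > 0"
      have "\<forall>\<^sub>F X in finite_subsets_at_top UNIV. \<forall>t\<in>UNIV. dist (\<Sum>k\<in>X. e k t) (g t) < \<epsilon> / 2"
        using uniform_limitD[OF unif, of "\<epsilon> / 2"] \<epsilon> by simp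
      then show "\<forall>\<^sub>F X in finite_subsets_at_top UNIV.
          dist (fourier_coeff (\<lambda>t. \<Sum>k\<in>X. e k t) m) (fourier_coeff g m) < \<epsilon>"
      proof eventually_elim
        case (elim X)
        have "norm (fourier_coeff (\<lambda>t. (\<Sum>k\<in>X. e k t) - g t) m) \<le> \<epsilon> / 2"
          using elim by (intro norm_fourier_coeff_le continuous_on_diff conte contg)
            (auto simp: dist_norm intro: less_imp_le)
        then show ?case
          using \<epsilon> by (subst (asm) fourier_coeff_diff[OF conte contg]) (simp add: dist_norm)
      qed
    qed
    moreover have "\<forall>\<^sub>F X in finite_subsets_at_top UNIV. fourier_coeff (\<lambda>t. \<Sum>k\<in>X. e k t) m = fourier_coeff f m"
    proof (rule eventually_finite_subsets_at_top[THEN iffD2], intro exI conjI allI impI)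
      fix X :: "int set" assume X: "finite X \<and> {m} \<subseteq> X \<and> X \<subseteq> UNIV"
      then have "fourier_coeff (\<lambda>t. \<Sum>k\<in>X. e k t) m = (\<Sum>k\<in>X. fourier_coeff (e k) m)"
        by (intro fourier_coeff_sum) (auto simp: e_def intro!: continuous_intros)
      also have "\<dots> = fourier_coeff f m"
        using X by (simp add: e_def fourier_coeff_cis)
      finally show "fourier_coeff (\<lambda>t. \<Sum>k\<in>X. e k t) m = fourier_coeff f m" .
    qed auto
    ultimately show ?thesis
      by (rule tendsto_unique[OF finite_subsets_at_top_neq_bot _ tendsto_eventually])
  qed
  have "f t - g t = 0" for t
  proof (rule fourier_coeff_unique)
    show "(\<lambda>t. f t - g t) \<in> C_2pi"
      using per perg cont contg by (auto simp: C_2pi_def periodic_def intro!: continuous_intros)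
  qed (simp add: fourier_coeff_diff cont contg coeffg)
  then have "g = f"
    by (auto simp: fun_eq_iff)
  then show ?thesis
    using per summ sums by (simp add: wiener_def e_def)
qed

subsection \<open>Positivity of the symbol\<close>

lemma norm_coord_le: "norm (coord x n) \<le> norm x"
proof -
  have "(norm (coord x n))\<^sup>2 \<le> (\<Sum>n. (norm (coord x n))\<^sup>2)"
    using sum_le_suminf[OF summable_coord[of x], of "{n}"] by simp
  then show ?thesis
    unfolding norm_ell2_def by (simp add: real_le_rsqrt)
qed

lemma coord_tendsto_zero: "coord x \<longlonglongrightarrow> 0"
proof -
  have "(\<lambda>n. sqrt ((norm (coord x n))\<^sup>2)) \<longlonglongrightarrow> sqrt 0"
    by (intro tendsto_intros summable_LIMSEQ_zero summable_coord)
  then show ?thesis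
    by (simp add: tendsto_norm_zero_iff)
qed

lemma norm_unit_vec: "norm (unit_vec j) = 1"
  using suminf_finite[of "{j}" "\<lambda>n. (norm (coord (unit_vec j) n))\<^sup>2"] by (simp add: norm_ell2_def)

lemma coord_sum: "coord (\<Sum>i\<in>S. f i) n = (\<Sum>i\<in>S. coord (f i) n)"
  by (induction S rule: infinite_finite_induct) auto

lemma cinner_combination:
  fixes c :: "nat \<Rightarrow> complex"
  shows "cinner_ell2 (\<Sum>i\<le>n. scaleC_ell2 (c i) (unit_vec (m + i))) w = (\<Sum>i\<le>n. cnj (c i) * coord w (m + i))"
proof -
  have add: "cinner_ell2 (x + y) w = cinner_ell2 x w + cinner_ell2 y w" for x y
    unfolding cinner_ell2_def suminf_add[OF summable_cinner summable_cinner] by (simp add: algebra_simps)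
  have single: "cinner_ell2 (scaleC_ell2 d (unit_vec k)) w = cnj d * coord w k" for d k
    unfolding cinner_ell2_def
    by (subst suminf_finite[of "{k}"]) auto
  show ?thesis
    by (induction n) (simp_all add: add single)
qed

text \<open>Otherwise \<open>K\<close> would map a sequence of unit vectors to a convergent sequence with limit \<open>y\<close>,
  although the coordinates of \<open>y\<close> tend to zero.\<close>

lemma compact_op_entries_tendsto_zero:
  assumes "compact_op K"
  shows "(\<lambda>m. coord (K (unit_vec (m + j))) (m + i)) \<longlonglongrightarrow> 0"
proof (rule ccontr)
  assume "\<not> ?thesis"
  then obtain e where e: "e > 0" "\<not> (\<forall>\<^sub>F m in sequentially. norm (coord (K (unit_vec (m + j))) (m + i)) < e)"
    by (auto simp: tendsto_iff)
  obtain r :: "nat \<Rightarrow> nat" where r: "strict_mono r" "\<And>n. \<not> norm (coord (K (unit_vec (r n + j))) (r n + i)) < e"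
    using not_eventually_sequentiallyD[OF e(2)] by blast
  have "seq_compact (closure (K ` cball 0 1))"
    using assms by (simp add: compact_op_def compact_imp_seq_compact)
  moreover have "K (unit_vec (r n + j)) \<in> closure (K ` cball 0 1)" for n
    by (rule closure_subset[THEN subsetD], rule imageI) (simp add: norm_unit_vec)
  ultimately obtain y s where s: "strict_mono s" "((\<lambda>n. K (unit_vec (r n + j))) \<circ> s) \<longlonglongrightarrow> y"
    unfolding seq_compact_def by metis
  have "(\<lambda>n. norm (K (unit_vec (r (s n) + j)) - y)) \<longlonglongrightarrow> 0"
    using s(2) by (simp add: o_def LIM_zero tendsto_norm_zero)
  moreover have "(\<lambda>n. norm (coord y (r (s n) + i))) \<longlonglongrightarrow> 0"
  proof -
    have "filterlim (\<lambda>n. r (s n) + i) sequentially sequentially"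
      using filterlim_compose[OF filterlim_subseq[OF r(1)] filterlim_subseq[OF s(1)]]
      by (rule filterlim_at_top_mono) simp
    then show ?thesis
      using filterlim_compose[OF coord_tendsto_zero] by (intro tendsto_norm_zero)
  qed
  ultimately have "(\<lambda>n. norm (K (unit_vec (r (s n) + j)) - y) + norm (coord y (r (s n) + i))) \<longlonglongrightarrow> 0"
    by (auto intro: tendsto_add_zero)
  moreover have "e \<le> norm (K (unit_vec (r (s n) + j)) - y) + norm (coord y (r (s n) + i))" for n
  proof -
    have "e \<le> norm (coord (K (unit_vec (r (s n) + j)) - y) (r (s n) + i) + coord y (r (s n) + i))"
      using r(2)[of "s n"] by simp
    also have "\<dots> \<le> norm (K (unit_vec (r (s n) + j)) - y) + norm (coord y (r (s n) + i))"
      by (rule norm_triangle_mono[OF norm_coord_le order_refl])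
    finally show ?thesis .
  qed
  ultimately have "e \<le> 0"
    by (intro tendsto_lowerbound[of _ _ sequentially e]) auto
  then show False
    using e(1) by simp
qed

text \<open>A Toeplitz matrix is constant along diagonals, so only the entry of the compact part
  varies with \<open>m\<close>, and it dies out.\<close>

lemma has_symbol_entries_tendsto:
  assumes "has_symbol A a"
  shows "(\<lambda>m. coord (A (unit_vec (m + j))) (m + i)) \<longlonglongrightarrow> fourier_coeff a (int j - int i)"
proof -
  obtain T K where TK: "toeplitz_op a T" "compact_op K" "A = (\<lambda>x. T x + K x)"
    using assms unfolding has_symbol_def by blast
  have "(\<lambda>m. fourier_coeff a (int j - int i) + coord (K (unit_vec (m + j))) (m + i))
      \<longlonglongrightarrow> fourier_coeff a (int j - int i) + 0"
    by (intro tendsto_intros compact_op_entries_tendsto_zero TK)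
  then show ?thesis
    using TK(1) by (simp add: TK(3) toeplitz_op_def)
qed

text \<open>Both conclusions are closed conditions and survive the limit: reality comes from
  self-adjointness, the lower bound from definiteness.\<close>

lemma symbol_form:
  assumes pd: "positive_definite A" and sym: "has_symbol A a"
  obtains \<gamma> where "\<gamma> > 0"
    "\<And>n c. Im (\<Sum>i\<le>n. \<Sum>j\<le>n. cnj (c i) * c j * fourier_coeff a (int j - int i)) = 0"
    "\<And>n c. \<gamma> * (\<Sum>i\<le>n. (norm (c i))\<^sup>2) \<le> Re (\<Sum>i\<le>n. \<Sum>j\<le>n. cnj (c i) * c j * fourier_coeff a (int j - int i))"
proof -
  obtain \<gamma> where \<gamma>: "\<gamma> > 0" "\<And>v. \<gamma> * (norm v)\<^sup>2 \<le> Re (cinner_ell2 v (A v))"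
    using pd unfolding positive_definite_def by blast
  have lin: "linear A" and hom: "A (scaleC_ell2 c x) = scaleC_ell2 c (A x)" for c x
    using pd by (auto simp: positive_definite_def bounded_op_def bounded_linear.linear)
  have sa: "cinner_ell2 (A x) y = cinner_ell2 x (A y)" for x y
    using pd by (auto simp: positive_definite_def self_adjoint_def)
  have cnj: "cinner_ell2 x y = cnj (cinner_ell2 y x)" for x y
  proof -
    have "(\<lambda>n. cnj (cnj (coord y n) * coord x n)) sums cnj (cinner_ell2 y x)"
      unfolding cinner_ell2_def sums_cnj using summable_cinner by (rule summable_sums)
    then show ?thesis
      unfolding cinner_ell2_def by (simp add: sums_iff mult.commute)
  qed
  have real: "Im (cinner_ell2 v (A v)) = 0" for v
    using arg_cong[OF cnj[of v "A v"], of Im] sa[of v v] by simp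
  \<comment> \<open>\<open>v n c m\<close> carries the coefficients \<open>c\<close> at the
    positions m to m + n. Its norm does not depend on \<open>m\<close>, which preserves \<gamma> in
    the limit.\<close>
  define v where "v = (\<lambda>n (c :: nat \<Rightarrow> complex) m. \<Sum>i\<le>n. scaleC_ell2 (c i) (unit_vec (m + i)))"
  define q where "q = (\<lambda>n c m. cinner_ell2 (v n c m) (A (v n c m)))"
  have Av: "A (v n c m) = (\<Sum>j\<le>n. scaleC_ell2 (c j) (A (unit_vec (m + j))))" for n c m
    unfolding v_def linear_sum[OF lin] hom ..
  have q: "q n c m = (\<Sum>i\<le>n. \<Sum>j\<le>n. cnj (c i) * c j * coord (A (unit_vec (m + j))) (m + i))" for n c m
    unfolding q_def Av unfolding v_def cinner_combination
    by (simp add: coord_sum sum_distrib_left mult.assoc)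
  have lim: "q n c \<longlonglongrightarrow> (\<Sum>i\<le>n. \<Sum>j\<le>n. cnj (c i) * c j * fourier_coeff a (int j - int i))" for n c
    unfolding q by (intro tendsto_intros has_symbol_entries_tendsto sym)
  have normv: "(norm (v n c m))\<^sup>2 = (\<Sum>i\<le>n. (norm (c i))\<^sup>2)" for n c m
  proof -
    have "coord (v n c m) (m + i) = c i" if "i \<le> n" for i
    proof -
      have "coord (v n c m) (m + i) = (\<Sum>j\<le>n. if i = j then c j else 0)"
        unfolding v_def coord_sum by (intro sum.cong) auto
      then show ?thesis
        using that by simp
    qed
    then have "cinner_ell2 (v n c m) (v n c m) = (\<Sum>i\<le>n. cnj (c i) * c i)"
      by (subst (1) v_def) (simp add: cinner_combination)
    moreover have "Re (cnj z * z) = (norm z)\<^sup>2" for z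
      by (simp only: cmod_power2) (simp add: power2_eq_square)
    ultimately show ?thesis
      by (simp add: power2_norm_eq_inner inner_ell2_def del: times_complex.simps)
  qed
  show thesis
  proof
    fix n and c :: "nat \<Rightarrow> complex"
    have "(\<lambda>m. Im (q n c m)) \<longlonglongrightarrow> Im (\<Sum>i\<le>n. \<Sum>j\<le>n. cnj (c i) * c j * fourier_coeff a (int j - int i))"
      by (intro tendsto_intros lim)
    then show "Im (\<Sum>i\<le>n. \<Sum>j\<le>n. cnj (c i) * c j * fourier_coeff a (int j - int i)) = 0"
      unfolding q_def real by (simp add: LIMSEQ_const_iff)
    have "(\<lambda>m. Re (q n c m)) \<longlonglongrightarrow> Re (\<Sum>i\<le>n. \<Sum>j\<le>n. cnj (c i) * c j * fourier_coeff a (int j - int i))"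
      by (intro tendsto_intros lim)
    moreover have "\<gamma> * (\<Sum>i\<le>n. (norm (c i))\<^sup>2) \<le> Re (q n c m)" for m
      using \<gamma>(2)[of "v n c m"] unfolding normv q_def .
    ultimately show "\<gamma> * (\<Sum>i\<le>n. (norm (c i))\<^sup>2) \<le> Re (\<Sum>i\<le>n. \<Sum>j\<le>n. cnj (c i) * c j * fourier_coeff a (int j - int i))"
      by (intro tendsto_lowerbound[of _ _ sequentially]) auto
  qed (rule \<gamma>(1))
qed

text \<open>For the constant function 1 the Toeplitz form is the squared norm of the vector. The
  bound on forms thus says that the kernel integrals of Re a - \<gamma> are nonnegative, and the
  symbol inherits the \<gamma> of the form.\<close>

lemma symbol_positive:
  assumes pd: "positive_definite A" and sym: "has_symbol A a"
  obtains \<gamma> where "\<gamma> > 0" "\<And>t. Im (a t) = 0" "\<And>t. \<gamma> \<le> Re (a t)"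
proof -
  obtain \<gamma> where \<gamma>: "\<gamma> > 0"
    "\<And>n c. Im (\<Sum>i\<le>n. \<Sum>j\<le>n. cnj (c i) * c j * fourier_coeff a (int j - int i)) = 0"
    "\<And>n c. \<gamma> * (\<Sum>i\<le>n. (norm (c i))\<^sup>2) \<le> Re (\<Sum>i\<le>n. \<Sum>j\<le>n. cnj (c i) * c j * fourier_coeff a (int j - int i))"
    using symbol_form[OF pd sym] by blast
  have cont: "continuous_on UNIV a" and per: "periodic a"
    using sym by (auto simp: has_symbol_def C_2pi_def)
  define c where "c = (\<lambda>s n j. of_nat (n choose j) * cis (of_nat j * s))"
  define w where "w = (\<lambda>(s::real) n (t::real). (2 + 2 * cos (t - s)) ^ n)"
  have contw: "continuous_on UNIV (w s n)" for s n
    unfolding w_def by (intro continuous_intros)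
  have int: "((\<lambda>t. f t * of_real (w s n t)) has_integral
     2 * pi * (\<Sum>i\<le>n. \<Sum>j\<le>n. cnj (c s n i) * c s n j * fourier_coeff f (int j - int i))) {0..2 * pi}"
    if "continuous_on UNIV f" for f s n
  proof -
    have "(\<lambda>t. f t * of_real (w s n t)) integrable_on {0..2 * pi}"
      by (intro continuous_integrable_on continuous_on_mult continuous_on_of_real that contw)
    then show ?thesis
      using integral_kernel[OF that, of s n] unfolding c_def w_def by (simp add: has_integral_iff)
  qed
  have one: "(\<lambda>t. 1) = (\<lambda>t. 1 * cis (of_int 0 * t))"
    by simp
  have "((\<lambda>t. 1 * complex_of_real (w s n t)) has_integral
     2 * pi * (\<Sum>i\<le>n. of_real ((norm (c s n i))\<^sup>2))) {0..2 * pi}" for s n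
  proof -
    have "(\<Sum>i\<le>n. \<Sum>j\<le>n. cnj (c s n i) * c s n j * fourier_coeff (\<lambda>t. 1) (int j - int i))
        = (\<Sum>i\<le>n. \<Sum>j\<le>n. if i = j then cnj (c s n i) * c s n j else 0)"
      by (subst one, subst fourier_coeff_cis) (intro sum.cong refl, auto)
    also have "\<dots> = (\<Sum>i\<le>n. of_real ((norm (c s n i))\<^sup>2))"
      by (simp add: complex_norm_square mult.commute del: of_real_power)
    finally show ?thesis
      using int[of "\<lambda>t. 1" s n] by simp
  qed
  from has_integral_linear[OF this bounded_linear_Re]
  have intw: "(w s n has_integral 2 * pi * (\<Sum>i\<le>n. (norm (c s n i))\<^sup>2)) {0..2 * pi}" for s n
    by (simp add: o_def flip: of_real_power)
  have Re: "Re (a s) - \<gamma> \<ge> 0" and Im1: "Im (a s) \<ge> 0" and Im2: "- Im (a s) \<ge> 0" if "s \<in> {0..2 * pi}" for s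
  proof -
    have intRe: "((\<lambda>t. Re (a t) * w s n t) has_integral
        2 * pi * Re (\<Sum>i\<le>n. \<Sum>j\<le>n. cnj (c s n i) * c s n j * fourier_coeff a (int j - int i))) {0..2 * pi}" for s n
      using has_integral_linear[OF int[OF cont, of s n] bounded_linear_Re] by (simp add: o_def)
    have intIm: "((\<lambda>t. Im (a t) * w s n t) has_integral 0) {0..2 * pi}" for s n
      using has_integral_linear[OF int[OF cont, of s n] bounded_linear_Im] \<gamma>(2)[where n = n and c = "c s n"] by (simp add: o_def del: Im_sum)
    have "integral {0..2 * pi} (\<lambda>t. (Re (a t) - \<gamma>) * w s n t) \<ge> 0" for s n
      using has_integral_diff[OF intRe[of s n] has_integral_mult_right[OF intw[of s n], of \<gamma>]] \<gamma>(3)[where n=n and c="c s n"]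
      by (simp add: integral_unique left_diff_distrib mult.left_commute del: Re_sum)
    then show "Re (a s) - \<gamma> \<ge> 0"
      unfolding w_def
      by (rule nonneg_on_period[where f = "\<lambda>t. Re (a t) - \<gamma>", OF _ _ that, rotated]) (intro continuous_intros cont)
    have "integral {0..2 * pi} (\<lambda>t. Im (a t) * w s n t) \<ge> 0"
      "integral {0..2 * pi} (\<lambda>t. - Im (a t) * w s n t) \<ge> 0" for s n
      using integral_unique[OF intIm[of s n]] by simp_all
    note Im = this[unfolded w_def]
    show "Im (a s) \<ge> 0"
      by (rule nonneg_on_period[where f = "\<lambda>t. Im (a t)", OF _ Im(1) that]) (intro continuous_intros cont)
    show "- Im (a s) \<ge> 0"
      by (rule nonneg_on_period[where f = "\<lambda>t. - Im (a t)", OF _ Im(2) that]) (intro continuous_intros cont)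
  qed
  show thesis
  proof
    fix t
    obtain s where "0 \<le> s" "s \<le> 2 * pi" "a t = a s"
      using periodic_reduce[OF per] by metis
    then show "Im (a t) = 0" "\<gamma> \<le> Re (a t)"
      using Re[of s] Im1[of s] Im2[of s] by auto
  qed (rule \<gamma>(1))
qed

subsection \<open>Bernstein's theorem\<close>

text \<open>On [0, 2 pi - h] the modulus bound telescopes. \<open>G\<close> is not periodic, so on
  the last stretch of length \<open>h\<close> the increment is split at the end point by means of f
  (2 pi) = f 0. The two parts contribute 1 and 4 to the constant 5.\<close>

lemma integral_squared_increment_le:
  assumes f: "f \<in> C_2pi" and G: "modulus_bound \<beta> G f" and "\<beta> > 0" and h: "0 < h" "h \<le> 2 * pi"
  shows "integral {0..2 * pi} (\<lambda>t. (norm (f (t + h) - f t))\<^sup>2)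
    \<le> 5 * (G (2 * pi) - G 0) * h powr (1 + \<beta>)"
proof -
  have cont: "continuous_on UNIV f" and per: "periodic f"
    using f by (auto simp: C_2pi_def)
  have mono: "mono_on {0..2 * pi} G"
    and bound: "\<And>x y. 0 \<le> x \<Longrightarrow> x \<le> y \<Longrightarrow> y \<le> 2 * pi \<Longrightarrow>
      (norm (f y - f x))\<^sup>2 \<le> (y - x) powr \<beta> * (G y - G x)"
    using G unfolding modulus_bound_def by blast+
  have G_mono: "G x \<le> G y" if "0 \<le> x" "x \<le> y" "y \<le> 2 * pi" for x y
    using mono_onD[OF mono, of x y] that by simp
  define \<Delta> where "\<Delta> = G (2 * pi) - G 0"
  have \<Delta>: "0 \<le> \<Delta>"
    using G_mono[of 0 "2 * pi"] by (simp add: \<Delta>_def)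
  have crude: "(norm (f y - f x))\<^sup>2 \<le> h powr \<beta> * \<Delta>"
    if xy: "0 \<le> x" "x \<le> y" "y \<le> 2 * pi" "y - x \<le> h" for x y
  proof -
    have "(norm (f y - f x))\<^sup>2 \<le> (y - x) powr \<beta> * (G y - G x)"
      by (rule bound) (use xy in auto)
    also have "\<dots> \<le> h powr \<beta> * \<Delta>"
      using G_mono[of 0 x] G_mono[of x y] G_mono[of y "2 * pi"] xy \<open>\<beta> > 0\<close>
      unfolding \<Delta>_def by (intro mult_mono powr_mono2) auto
    finally show ?thesis .
  qed
  define F where "F = (\<lambda>t. (norm (f (t + h) - f t))\<^sup>2)"
  have contF: "continuous_on S F" for S
    unfolding F_def
    by (intro continuous_intros continuous_on_compose2[OF cont] continuous_on_subset[OF cont]) auto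
  have intF: "F integrable_on {a..b}" for a b
    by (intro integrable_continuous_real contF)
  have intG: "G integrable_on {a..b}" if "0 \<le> a" "b \<le> 2 * pi" for a b
    by (rule integrable_on_mono_on, rule mono_on_subset[OF mono]) (use that in auto)
  have shiftG: "integral {0..2 * pi - h} (\<lambda>t. G (t + h)) = integral {h..2 * pi} G"
    and intG': "(\<lambda>t. G (t + h)) integrable_on {0..2 * pi - h}"
    using integral_shift_Icc_real[of 0 "2 * pi - h" G h]
      has_integral_shift_Icc_real[of G h _ 0 "2 * pi - h"] intG[of h "2 * pi"] h
    by (auto simp: o_def add.commute integrable_on_def)
  have first: "integral {0..2 * pi - h} F \<le> h powr \<beta> * (h * \<Delta>)"
  proof -
    have "integral {0..2 * pi - h} F \<le> integral {0..2 * pi - h} (\<lambda>t. h powr \<beta> * (G (t + h) - G t))"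
    proof (rule integral_le[OF intF])
      show "(\<lambda>t. h powr \<beta> * (G (t + h) - G t)) integrable_on {0..2 * pi - h}"
        using h intG' by (intro integrable_on_mult_right integrable_diff intG) auto
      show "F t \<le> h powr \<beta> * (G (t + h) - G t)" if "t \<in> {0..2 * pi - h}" for t
        using bound[of t "t + h"] that h by (simp add: F_def)
    qed
    also have "\<dots> = h powr \<beta> * (integral {h..2 * pi} G - integral {0..2 * pi - h} G)"
      using h by (simp add: Henstock_Kurzweil_Integration.integral_diff intG' intG shiftG)
    \<comment> \<open>Both ranges are complements of end pieces of length \<open>h\<close> in the
      period; the identity also holds when these pieces overlap.\<close>
    also have "integral {h..2 * pi} G - integral {0..2 * pi - h} G
        = integral {2 * pi - h..2 * pi} G - integral {0..h} G"
      using Henstock_Kurzweil_Integration.integral_combine[of 0 h "2 * pi" G]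
        Henstock_Kurzweil_Integration.integral_combine[of 0 "2 * pi - h" "2 * pi" G] h intG
      by simp
    also have "\<dots> \<le> h * G (2 * pi) - h * G 0"
    proof (rule diff_mono)
      have "integral {2 * pi - h..2 * pi} G \<le> integral {2 * pi - h..2 * pi} (\<lambda>t. G (2 * pi))"
        using h by (intro integral_le intG G_mono) auto
      then show "integral {2 * pi - h..2 * pi} G \<le> h * G (2 * pi)"
        using h by simp
      have "integral {0..h} (\<lambda>t. G 0) \<le> integral {0..h} G"
        using h by (intro integral_le intG G_mono) auto
      then show "h * G 0 \<le> integral {0..h} G"
        using h by simp
    qed
    finally show ?thesis
      by (simp add: \<Delta>_def right_diff_distrib mult_left_mono)
  qed
  have second: "integral {2 * pi - h..2 * pi} F \<le> 4 * h powr \<beta> * (h * \<Delta>)"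
  proof -
    have "integral {2 * pi - h..2 * pi} F \<le> integral {2 * pi - h..2 * pi} (\<lambda>t. 4 * (h powr \<beta> * \<Delta>))"
    proof (rule integral_le[OF intF])
      fix t assume t: "t \<in> {2 * pi - h..2 * pi}"
      have "f (t + h) = f (t + h - 2 * pi)" "f (2 * pi) = f 0"
        using per unfolding periodic_def by (metis diff_add_cancel, metis add_0)
      then have "F t = (norm ((f (t + h - 2 * pi) - f 0) + (f (2 * pi) - f t)))\<^sup>2"
        by (simp add: F_def)
      also have "\<dots> \<le> 2 * (norm (f (t + h - 2 * pi) - f 0))\<^sup>2 + 2 * (norm (f (2 * pi) - f t))\<^sup>2"
        by (rule norm_sum_sq_le)
      also have "\<dots> \<le> 2 * (h powr \<beta> * \<Delta>) + 2 * (h powr \<beta> * \<Delta>)"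
        using t h by (intro add_mono mult_left_mono crude) auto
      finally show "F t \<le> 4 * (h powr \<beta> * \<Delta>)"
        by linarith
    qed auto
    then show ?thesis
      using h by (simp add: mult_ac)
  qed
  have "integral {0..2 * pi} F = integral {0..2 * pi - h} F + integral {2 * pi - h..2 * pi} F"
    using Henstock_Kurzweil_Integration.integral_combine[of 0 "2 * pi - h" "2 * pi" F] h intF by simp
  also have "\<dots> \<le> h powr \<beta> * (h * \<Delta>) + 4 * h powr \<beta> * (h * \<Delta>)"
    by (rule add_mono[OF first second])
  also have "\<dots> = 5 * \<Delta> * h powr (1 + \<beta>)"
    using h by (simp add: powr_add)
  finally show ?thesis
    by (simp add: F_def \<Delta>_def)
qed

section \<open>Dyadic blocks of frequencies\<close>

definition dyadic_block :: "nat \<Rightarrow> int set" where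
  "dyadic_block m = {k. 2 ^ m \<le> \<bar>k\<bar> \<and> \<bar>k\<bar> < 2 ^ Suc m}"

lemma dyadic_block_eq: "dyadic_block m = {2 ^ m..<2 ^ Suc m} \<union> {- (2 ^ Suc m)<..- (2 ^ m)}"
  by (auto simp: dyadic_block_def abs_if split: if_splits)

lemma finite_dyadic_block: "finite (dyadic_block m)"
  by (simp add: dyadic_block_eq)

lemma card_dyadic_block: "card (dyadic_block m) \<le> 2 ^ Suc m"
proof -
  have "card (dyadic_block m) \<le> card {2 ^ m..<2 ^ Suc m :: int} + card {- (2 ^ Suc m)<..- (2 ^ m) :: int}"
    unfolding dyadic_block_eq by (rule card_Un_le)
  also have "\<dots> = 2 ^ Suc m"
    by (simp add: nat_power_eq)
  finally show ?thesis .
qed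

text \<open>For \<open>k\<close> in the block, \<open>k h\<close> lies between \<open>\<pi>/3\<close> and \<open>2\<pi>/3\<close> in absolute value,
  so the factor \<open>e\<^sup>i\<^sup>k\<^sup>h - 1\<close> gained by the increment of step \<open>h\<close> has modulus at least one.\<close>

lemma sum_dyadic_block_squared_le:
  assumes f: "f \<in> C_2pi"
  defines "h \<equiv> \<lambda>m. pi / (3 * 2 ^ m)"
  shows "2 * pi * (\<Sum>k\<in>dyadic_block m. (norm (fourier_coeff f k))\<^sup>2)
    \<le> integral {0..2 * pi} (\<lambda>t. (norm (f (t + h m) - f t))\<^sup>2)"
proof -
  have cont: "continuous_on UNIV f" and per: "periodic f"
    using f by (auto simp: C_2pi_def)
  have six: "(1::real) \<le> 6 * 2 ^ m"
    using one_le_power[of "2 :: real" m] by linarith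
  have h: "0 \<le> h m" "h m \<le> 2 * pi"
    using six by (auto simp: h_def field_simps)
  have cont': "continuous_on UNIV (\<lambda>t. f (t + h m))"
    by (intro continuous_on_compose2[OF cont] continuous_intros) auto
  have "norm (fourier_coeff f k) \<le> norm (fourier_coeff (\<lambda>t. f (t + h m) - f t) k)"
    if k: "k \<in> dyadic_block m" for k
  proof -
    define x where "x = of_int \<bar>k\<bar> * h m"
    have "2 ^ m \<le> real_of_int \<bar>k\<bar>" "real_of_int \<bar>k\<bar> \<le> 2 * 2 ^ m"
    proof -
      have "2 ^ m \<le> \<bar>k\<bar>" "\<bar>k\<bar> \<le> 2 * 2 ^ m"
        using k by (auto simp: dyadic_block_def)
      then have "real_of_int (2 ^ m) \<le> real_of_int \<bar>k\<bar>" "real_of_int \<bar>k\<bar> \<le> real_of_int (2 * 2 ^ m)"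
        by (simp_all only: of_int_le_iff)
      then show "2 ^ m \<le> real_of_int \<bar>k\<bar>" "real_of_int \<bar>k\<bar> \<le> 2 * 2 ^ m"
        by simp_all
    qed
    then have x: "pi / 3 \<le> x" "x \<le> pi"
      unfolding x_def h_def by (simp_all add: field_simps)
    have "cos (of_int k * h m) = cos x"
      unfolding x_def by (cases "k \<ge> 0") simp_all
    also have "\<dots> \<le> cos (pi / 3)"
      using x by (intro cos_monotone_0_pi_le) auto
    finally have c: "cos (of_int k * h m) \<le> 1 / 2"
      by (simp add: cos_60)
    have "(norm (cis (of_int k * h m) - 1))\<^sup>2 = 2 - 2 * cos (of_int k * h m)"
      using sin_cos_squared_add[of "of_int k * h m"]
      by (simp add: cmod_power2 power2_diff)
    then have "1\<^sup>2 \<le> (norm (cis (of_int k * h m) - 1))\<^sup>2"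
      using c by simp
    then have "1 \<le> norm (cis (of_int k * h m) - 1)"
      by (rule power2_le_imp_le) simp
    then have "norm (fourier_coeff f k) \<le> norm (cis (of_int k * h m) - 1) * norm (fourier_coeff f k)"
      by (simp add: mult_le_cancel_right1)
    also have "\<dots> = norm (fourier_coeff (\<lambda>t. f (t + h m) - f t) k)"
      by (simp add: fourier_coeff_diff[OF cont' cont] fourier_coeff_shift[OF cont per h]
          left_diff_distrib flip: norm_mult)
    finally show ?thesis .
  qed
  then have "2 * pi * (\<Sum>k\<in>dyadic_block m. (norm (fourier_coeff f k))\<^sup>2)
      \<le> 2 * pi * (\<Sum>k\<in>dyadic_block m. (norm (fourier_coeff (\<lambda>t. f (t + h m) - f t) k))\<^sup>2)"
    by (intro mult_left_mono sum_mono power_mono) auto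
  also have "\<dots> \<le> integral {0..2 * pi} (\<lambda>t. (norm (f (t + h m) - f t))\<^sup>2)"
    by (intro bessel_inequality continuous_on_diff cont cont' finite_dyadic_block)
  finally show ?thesis .
qed

lemma finite_int_subset_dyadic_blocks:
  assumes "finite X"
  obtains N where "X \<subseteq> insert 0 (\<Union>m<N. dyadic_block m)"
proof -
  have ex: "\<exists>m. k \<in> dyadic_block m" if "k \<noteq> 0" for k
    using ex_power_ivl1[of 2 "nat \<bar>k\<bar>"] that
    by (auto simp: dyadic_block_def nat_less_iff le_nat_iff)
  have "\<forall>k. \<exists>m. k \<noteq> 0 \<longrightarrow> k \<in> dyadic_block m"
    using ex by blast
  then obtain b where b: "\<And>k. k \<noteq> 0 \<Longrightarrow> k \<in> dyadic_block (b k)"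
    by metis
  obtain N where "\<And>k. k \<in> X \<Longrightarrow> b k < N"
    using assms finite_nat_set_iff_bounded[of "b ` X"] by auto
  then have "X \<subseteq> insert 0 (\<Union>m<N. dyadic_block m)"
    using b by blast
  then show thesis
    by (rule that)
qed

text \<open>The constant depends on \<open>\<beta>\<close> and \<open>G\<close> only, hence a small \<open>M\<close> gives a small Wiener norm.\<close>

lemma wiener_norm_bound:
  assumes "\<beta> > 0" and mono: "mono_on {0..2 * pi} G"
  obtains C where "\<And>f M. f \<in> C_2pi \<Longrightarrow> 0 \<le> M \<Longrightarrow> (\<And>t. norm (f t) \<le> M) \<Longrightarrow>
    modulus_bound \<beta> (\<lambda>t. M\<^sup>2 * G t) f \<Longrightarrow> f \<in> wiener \<and> wiener_norm f \<le> C * M"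
proof -
  define \<Delta> where "\<Delta> = G (2 * pi) - G 0"
  have \<Delta>: "0 \<le> \<Delta>"
    using mono_onD[OF mono, of 0 "2 * pi"] by (simp add: \<Delta>_def)
  \<comment> \<open>Cauchy-Schwarz on block \<open>m\<close>, with at most 2^(m + 1) indices, and
    the step pi / (3 * 2^m) bound the squared block sum by the square of M * D * r^m. The powers of
    2 combine to 2^m * 2^(-m (1 + \<beta>)) = r^(2 m); the remaining factors form
    \<open>D\<close>.\<close>
  define D where "D = sqrt (5 * \<Delta> * (pi / 3) powr (1 + \<beta>) / pi)"
  define r :: real where "r = 2 powr (- \<beta> / 2)"
  have D: "0 \<le> D"
    using \<Delta> by (simp add: D_def)
  have r: "0 < r" "r < 1"
    using \<open>\<beta> > 0\<close> by (auto simp: r_def powr_less_one)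
  \<comment> \<open>The summand 1 pays for the frequency 0, which lies in no block, and the
    geometric series for the blocks.\<close>
  have main: "f \<in> wiener \<and> wiener_norm f \<le> (1 + D / (1 - r)) * M"
    if f: "f \<in> C_2pi" and M: "0 \<le> M" and fM: "\<And>t. norm (f t) \<le> M"
      and bound: "modulus_bound \<beta> (\<lambda>t. M\<^sup>2 * G t) f" for f M
  proof -
    have cont: "continuous_on UNIV f"
      using f by (simp add: C_2pi_def)
    have block: "(\<Sum>k\<in>dyadic_block m. norm (fourier_coeff f k)) \<le> M * D * r ^ m" for m
    proof -
      define h where "h = pi / (3 * 2 ^ m)"
      have six: "(1::real) \<le> 6 * 2 ^ m"
        using one_le_power[of "2 :: real" m] by linarith
      have h: "0 < h" "h \<le> 2 * pi"
        using six by (auto simp: h_def field_simps)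
      have "2 * pi * (\<Sum>k\<in>dyadic_block m. (norm (fourier_coeff f k))\<^sup>2)
          \<le> 5 * (M\<^sup>2 * G (2 * pi) - M\<^sup>2 * G 0) * h powr (1 + \<beta>)"
        using sum_dyadic_block_squared_le[OF f, of m]
          integral_squared_increment_le[OF f bound \<open>\<beta> > 0\<close> h] unfolding h_def by linarith
      then have sq: "(\<Sum>k\<in>dyadic_block m. (norm (fourier_coeff f k))\<^sup>2)
          \<le> M\<^sup>2 * (5 * \<Delta> * h powr (1 + \<beta>)) / (2 * pi)"
        by (simp add: \<Delta>_def field_simps)
      have hr: "2 ^ Suc m * h powr (1 + \<beta>) = 2 * (pi / 3) powr (1 + \<beta>) * (r ^ m)\<^sup>2"
      proof -
        have two: "(2 ^ m :: real) = 2 powr m"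
          by (simp add: powr_realpow)
        have "(r ^ m)\<^sup>2 = 2 powr (- \<beta> * m)"
          unfolding r_def by (simp add: powr_power mult.commute flip: power_mult)
        moreover have "2 powr m * h powr (1 + \<beta>) = (pi / 3) powr (1 + \<beta>) * 2 powr (- \<beta> * m)"
        proof -
          have hm: "h = (pi / 3) * 2 powr (- real m)"
            by (simp add: h_def two powr_minus field_simps)
          have "h powr (1 + \<beta>) = (pi / 3) powr (1 + \<beta>) * (2 powr (- real m)) powr (1 + \<beta>)"
            unfolding hm by (rule powr_mult)
          also have "(2 powr (- real m)) powr (1 + \<beta>) = 2 powr (- real m - \<beta> * m)"
            by (simp add: powr_powr algebra_simps)
          finally show ?thesis
            by (simp add: mult.left_commute flip: powr_add)
        qed
        ultimately show ?thesis
          by (simp add: two)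
      qed
      have "(\<Sum>k\<in>dyadic_block m. norm (fourier_coeff f k))\<^sup>2
          \<le> (\<Sum>k\<in>dyadic_block m. (norm (fourier_coeff f k))\<^sup>2) * card (dyadic_block m)"
        by (rule sum_squared_le_sum_of_squares)
      also have "\<dots> \<le> M\<^sup>2 * (5 * \<Delta> * h powr (1 + \<beta>)) / (2 * pi) * 2 ^ Suc m"
        using sq of_nat_mono[OF card_dyadic_block[of m], where 'a = real] \<Delta>
        by (intro mult_mono) auto
      also have "\<dots> = M\<^sup>2 * (5 * \<Delta>) / (2 * pi) * (2 ^ Suc m * h powr (1 + \<beta>))"
        by simp
      also have "\<dots> = M\<^sup>2 * (5 * \<Delta> * (pi / 3) powr (1 + \<beta>) / pi) * (r ^ m)\<^sup>2"
        unfolding hr by simp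
      also have "5 * \<Delta> * (pi / 3) powr (1 + \<beta>) / pi = D\<^sup>2"
        using \<Delta> by (simp add: D_def)
      also have "M\<^sup>2 * D\<^sup>2 * (r ^ m)\<^sup>2 = (M * D * r ^ m)\<^sup>2"
        by (simp add: power_mult_distrib)
      finally show ?thesis
        by (rule power2_le_imp_le) (use M D r in simp)
    qed
    have fin: "(\<Sum>k\<in>X. norm (fourier_coeff f k)) \<le> (1 + D / (1 - r)) * M" if X: "finite X" for X
    proof -
      obtain N where N: "X \<subseteq> insert 0 (\<Union>m<N. dyadic_block m)"
        using finite_int_subset_dyadic_blocks[OF X] by blast
      have "(\<Sum>k\<in>X. norm (fourier_coeff f k))
          \<le> (\<Sum>k\<in>insert 0 (\<Union>m<N. dyadic_block m). norm (fourier_coeff f k))"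
        by (rule sum_mono2) (use N in \<open>auto simp: finite_dyadic_block\<close>)
      also have "\<dots> \<le> norm (fourier_coeff f 0) + (\<Sum>k\<in>(\<Union>m<N. dyadic_block m). norm (fourier_coeff f k))"
        by (subst sum.insert_if) (auto simp: finite_dyadic_block)
      also have "(\<Sum>k\<in>(\<Union>m<N. dyadic_block m). norm (fourier_coeff f k))
          \<le> (\<Sum>m<N. \<Sum>k\<in>dyadic_block m. norm (fourier_coeff f k))"
      proof (induction N)
        case (Suc N)
        have "(\<Sum>k\<in>(\<Union>m<Suc N. dyadic_block m). norm (fourier_coeff f k))
            \<le> (\<Sum>k\<in>dyadic_block N. norm (fourier_coeff f k))
              + (\<Sum>k\<in>(\<Union>m<N. dyadic_block m). norm (fourier_coeff f k))"
          by (simp add: lessThan_Suc sum_Un finite_dyadic_block sum_nonneg)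
        then show ?case
          using Suc by simp
      qed simp
      also have "\<dots> \<le> (\<Sum>m<N. M * D * r ^ m)"
        by (intro sum_mono block)
      also have "\<dots> = M * D * (\<Sum>m<N. r ^ m)"
        by (simp add: sum_distrib_left)
      also have "M * D * (\<Sum>m<N. r ^ m) \<le> M * D * (1 / (1 - r))"
        using sum_le_suminf[of "\<lambda>m. r ^ m" "{..<N}"] r suminf_geometric[of r] M D
        by (intro mult_left_mono) auto
      finally show ?thesis
        using norm_fourier_coeff_le[OF cont fM, of 0] by (simp add: algebra_simps)
    qed
    have summ: "(\<lambda>k. norm (fourier_coeff f k)) summable_on UNIV"
    proof (rule nonneg_bdd_above_summable_on)
      show "bdd_above (sum (\<lambda>k. norm (fourier_coeff f k)) ` {F. F \<subseteq> UNIV \<and> finite F})"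
        by (rule bdd_aboveI2[of _ _ "(1 + D / (1 - r)) * M"]) (simp add: fin)
    qed simp
    moreover have "wiener_norm f \<le> (1 + D / (1 - r)) * M"
      unfolding wiener_norm_def by (rule infsum_le_finite_sums[OF summ]) (rule fin)
    ultimately show ?thesis
      using wiener_if_summable[OF f] by blast
  qed
  show thesis
    by (rule that) (rule main)
qed

subsection \<open>The iterates in closed form\<close>

lemma sum_omit:
  fixes l :: "nat \<Rightarrow> real"
  assumes "i \<le> q"
  shows "(\<Sum>j<q. omit i l j) = (\<Sum>j<Suc q. l j) - l i"
  using assms
proof (induction q rule: dec_induct)
  case base
  have "(\<Sum>j<i. omit i l j) = (\<Sum>j<i. l j)"
    by (intro sum.cong) (auto simp: omit_def)
  then show ?case
    by simp
next
  case (step q)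
  then show ?case
    by (simp add: omit_def)
qed

text \<open>On logarithms, a step replaces an entry by the average of the other \<open>q\<close>
  entries. This preserves the overall average and multiplies the deviation from it by -1/q.
  \<open>G\<close> is abstract, required only to be geometric on positive arguments, because the
  closed form of \<open>alm_mean\<close> is itself proved with this lemma.\<close>

lemma alm_iter_exp:
  fixes l :: "nat \<Rightarrow> real"
  defines "m \<equiv> \<lambda>q. (\<Sum>j<Suc q. l j) / real (Suc q)"
  assumes G: "\<And>x (h :: nat \<Rightarrow> real). (\<forall>j<q. x j = of_real (exp (h j))) \<Longrightarrow> G x = of_real (exp ((\<Sum>j<q. h j) / real q))"
    and q: "q > 0" and x: "\<And>j. j < Suc q \<Longrightarrow> x j = of_real (exp (l j))" and i: "i < Suc q"
  shows "alm_iter G x k i = of_real (exp (m q + (- 1 / real q) ^ k * (l i - m q)))"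
  using i
proof (induction k arbitrary: i)
  case 0
  then show ?case
    using x by simp
next
  case (Suc k)
  define h where "h = (\<lambda>i. m q + (- 1 / real q) ^ k * (l i - m q))"
  have "omit i (alm_iter G x k) j = of_real (exp (omit i h j))" if "j < q" for j
    using Suc.IH[of j] Suc.IH[of "Suc j"] that by (simp add: omit_def h_def)
  then have "alm_iter G x (Suc k) i = of_real (exp ((\<Sum>j<q. omit i h j) / real q))"
    using G by simp
  also have "(\<Sum>j<q. omit i h j) = (\<Sum>j<Suc q. h j) - h i"
    using Suc.prems by (intro sum_omit) simp
  also have "(\<Sum>j<Suc q. h j)
      = real (Suc q) * m q + (- 1 / real q) ^ k * ((\<Sum>j<Suc q. l j) - real (Suc q) * m q)"
    unfolding h_def sum.distrib sum_distrib_left[symmetric] sum_subtractf by simp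
  also have "\<dots> = real (Suc q) * m q"
    by (simp add: m_def)
  also have "(real (Suc q) * m q - h i) / real q = m q + (- 1 / real q) ^ Suc k * (l i - m q)"
    using q by (simp add: h_def field_simps)
  finally show ?case .
qed

text \<open>For q = 1 the factor would be -1 and the iterates would alternate between two
  values.\<close>

lemma alm_iter_exp_limit:
  fixes m u :: real
  assumes "1 < q"
  shows "(\<lambda>k. complex_of_real (exp (m + (- 1 / real q) ^ k * u))) \<longlonglongrightarrow> of_real (exp m)"
proof -
  have "(\<lambda>k. complex_of_real (exp (m + (- 1 / real q) ^ k * u))) \<longlonglongrightarrow> of_real (exp (m + 0 * u))"
    using assms by (intro tendsto_intros LIMSEQ_power_zero) simp
  then show ?thesis
    by simp
qed

text \<open>The mean of \<open>q\<close> numbers drives the iteration for q + 1 numbers, whose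
  closed form provides the limit in the definite description; it is unique because limits of
  sequences are.\<close>

lemma alm_mean_exp:
  fixes l :: "nat \<Rightarrow> real"
  assumes "2 \<le> q" "\<forall>j<q. x j = of_real (exp (l j))"
  shows "alm_mean q x = of_real (exp ((\<Sum>j<q. l j) / real q))"
  using assms
proof (induction q arbitrary: x l rule: dec_induct)
  case base
  have "x 0 * x 1 = of_real (exp (l 0 + l 1))"
    using base by (simp add: exp_add)
  moreover have "sqrt (exp (l 0 + l 1)) = exp ((l 0 + l 1) / 2)"
    by (rule real_sqrt_unique) (simp_all flip: exp_double)
  ultimately show ?case
    by (simp add: numeral_2_eq_2)
next
  case (step q)
  define m where "m = (\<Sum>j<Suc q. l j) / real (Suc q)"
  have lim: "(\<lambda>k. alm_iter (alm_mean q) x k i) \<longlonglongrightarrow> of_real (exp m)" if "i < Suc q" for i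
    using alm_iter_exp_limit[of q m "l i - m"] step that
    by (subst alm_iter_exp[where l = l]) (auto simp: m_def)
  have "alm_mean (Suc q) x = (THE L. \<forall>i<Suc q. (\<lambda>k. alm_iter (alm_mean q) x k i) \<longlonglongrightarrow> L)"
    using step by simp
  also have "\<dots> = of_real (exp m)"
    using lim by (intro the_equality) (blast intro: LIMSEQ_unique)+
  finally show ?case
    by (simp add: m_def)
qed

lemma alm_seq_exp:
  fixes l :: "nat \<Rightarrow> real \<Rightarrow> real"
  assumes "3 \<le> p" "i < p" "\<And>j t. j < p \<Longrightarrow> a j t = of_real (exp (l j t))"
  defines "m \<equiv> \<lambda>t. (\<Sum>j<p. l j t) / real p"
  shows "alm_seq p a k i t = of_real (exp (m t + (- 1 / real (p - 1)) ^ k * (l i t - m t)))"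
proof -
  obtain q where p: "p = Suc q" "2 \<le> q"
    using assms(1) by (cases p) auto
  show ?thesis
    using alm_iter_exp[where q = q and G = "alm_mean q" and x = "\<lambda>j. a j t" and l = "\<lambda>j. l j t" and i = i]
      alm_mean_exp[OF p(2)] assms(2,3) p
    unfolding alm_seq_def m_def p by simp
qed

subsection \<open>Convergence in the Wiener norm\<close>

lemma abs_ln_diff_le:
  fixes u v :: real
  assumes "\<gamma> > 0" "\<gamma> \<le> u" "\<gamma> \<le> v"
  shows "\<bar>ln u - ln v\<bar> \<le> \<bar>u - v\<bar> / \<gamma>"
proof -
  have *: "ln x - ln y \<le> \<bar>x - y\<bar> / \<gamma>" if "\<gamma> \<le> x" "\<gamma> \<le> y" for x y
  proof -
    have "ln x - ln y \<le> (x - y) / y"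
      using that assms(1) by (intro ln_diff_le) auto
    also have "\<dots> \<le> \<bar>x - y\<bar> / y"
      using that assms(1) by (intro divide_right_mono) auto
    also have "\<dots> \<le> \<bar>x - y\<bar> / \<gamma>"
      using that assms(1) by (intro divide_left_mono mult_pos_pos) auto
    finally show ?thesis .
  qed
  show ?thesis
    using *[of u v] *[of v u] assms(2,3) by (simp add: abs_le_iff abs_minus_commute)
qed

lemma abs_exp_diff_le:
  fixes u v :: real
  assumes "u \<le> B" "v \<le> B"
  shows "\<bar>exp u - exp v\<bar> \<le> exp B * \<bar>u - v\<bar>"
proof -
  have *: "exp x - exp y \<le> exp B * \<bar>x - y\<bar>" if "x \<le> B" for x y :: real
  proof -
    have "1 - exp (y - x) \<le> \<bar>x - y\<bar>"
      using exp_ge_add_one_self[of "y - x"] by linarith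
    then have "exp x * (1 - exp (y - x)) \<le> exp x * \<bar>x - y\<bar>"
      by (intro mult_left_mono) auto
    also have "\<dots> \<le> exp B * \<bar>x - y\<bar>"
      using that by (intro mult_right_mono) auto
    finally show ?thesis
      by (simp add: right_diff_distrib exp_diff)
  qed
  show ?thesis
    using *[of u v] *[of v u] assms by (simp add: abs_le_iff abs_minus_commute)
qed

text \<open>In the application \<epsilon> is a power of the contraction factor and \<open>u\<close>
  is a logarithm minus the average; \<open>B\<close> bounds both terms, hence 2 B. All exponents
  then stay below 3 B.\<close>

lemma abs_exp_perturbation_le:
  fixes m u B :: real
  assumes "\<bar>m\<bar> \<le> B" "\<bar>u\<bar> \<le> 2 * B" "\<bar>\<epsilon>\<bar> \<le> 1"
  shows "\<bar>exp (m + \<epsilon> * u) - exp m\<bar> \<le> exp (3 * B) * (2 * B) * \<bar>\<epsilon>\<bar>"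
proof -
  have eu: "\<bar>\<epsilon> * u\<bar> \<le> 2 * B"
    using assms mult_mono[of "\<bar>\<epsilon>\<bar>" 1 "\<bar>u\<bar>" "2 * B"] by (simp add: abs_mult)
  have "\<bar>exp (m + \<epsilon> * u) - exp m\<bar> \<le> exp (3 * B) * \<bar>\<epsilon> * u\<bar>"
    using abs_exp_diff_le[of "m + \<epsilon> * u" "3 * B" m] assms eu by (simp add: abs_le_iff)
  also have "\<dots> \<le> exp (3 * B) * (\<bar>\<epsilon>\<bar> * (2 * B))"
    unfolding abs_mult using assms by (intro mult_left_mono) auto
  finally show ?thesis
    by (simp add: mult_ac)
qed

text \<open>The bound has to carry \<epsilon> and \<delta> at once, whereas separate estimates for
  the increments of the two exponentials give \<delta> alone. Factoring out e^m isolates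
  e^(\<epsilon> u) - 1, which is of order \<epsilon>. The 2 \<delta> stems from \<open>u\<close>
  being a difference of two functions with increments up to \<delta>.\<close>

lemma abs_exp_perturbation_diff_le:
  fixes m m' u u' B :: real
  assumes B: "\<bar>m\<bar> \<le> B" "\<bar>m'\<bar> \<le> B" "\<bar>u\<bar> \<le> 2 * B" "\<bar>u'\<bar> \<le> 2 * B" and "\<bar>\<epsilon>\<bar> \<le> 1"
    and \<delta>: "\<bar>m - m'\<bar> \<le> \<delta>" "\<bar>u - u'\<bar> \<le> 2 * \<delta>"
  shows "\<bar>(exp (m + \<epsilon> * u) - exp m) - (exp (m' + \<epsilon> * u') - exp m')\<bar>
    \<le> exp (3 * B) * (2 * B + 2) * \<bar>\<epsilon>\<bar> * \<delta>"
proof -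
  have eu: "\<bar>\<epsilon> * v\<bar> \<le> 2 * B" if "\<bar>v\<bar> \<le> 2 * B" for v
    using assms(5) that mult_mono[of "\<bar>\<epsilon>\<bar>" 1 "\<bar>v\<bar>" "2 * B"] by (simp add: abs_mult)
  have \<delta>0: "0 \<le> \<delta>"
    using \<delta>(1) by linarith
  have "\<bar>exp m - exp m'\<bar> * \<bar>exp (\<epsilon> * u) - 1\<bar> \<le> (exp B * \<delta>) * (exp (2 * B) * (\<bar>\<epsilon>\<bar> * (2 * B)))"
  proof (rule mult_mono)
    show "\<bar>exp m - exp m'\<bar> \<le> exp B * \<delta>"
      using B \<delta> by (intro order_trans[OF abs_exp_diff_le[of m B m']] mult_left_mono) auto
    have "\<bar>exp (\<epsilon> * u) - exp 0\<bar> \<le> exp (2 * B) * \<bar>\<epsilon> * u - 0\<bar>"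
      using eu[OF B(3)] by (intro abs_exp_diff_le) auto
    also have "\<dots> \<le> exp (2 * B) * (\<bar>\<epsilon>\<bar> * (2 * B))"
      using B(3) by (simp add: abs_mult mult_left_mono)
    finally show "\<bar>exp (\<epsilon> * u) - 1\<bar> \<le> exp (2 * B) * (\<bar>\<epsilon>\<bar> * (2 * B))"
      by simp
  qed (use \<delta>0 in auto)
  moreover have "exp m' * \<bar>exp (\<epsilon> * u) - exp (\<epsilon> * u')\<bar> \<le> exp B * (exp (2 * B) * (\<bar>\<epsilon>\<bar> * (2 * \<delta>)))"
  proof (rule mult_mono)
    have "\<bar>exp (\<epsilon> * u) - exp (\<epsilon> * u')\<bar> \<le> exp (2 * B) * \<bar>\<epsilon> * u - \<epsilon> * u'\<bar>"
      using eu[OF B(3)] eu[OF B(4)] by (intro abs_exp_diff_le) auto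
    also have "\<bar>\<epsilon> * u - \<epsilon> * u'\<bar> = \<bar>\<epsilon>\<bar> * \<bar>u - u'\<bar>"
      by (simp flip: abs_mult right_diff_distrib)
    also have "exp (2 * B) * (\<bar>\<epsilon>\<bar> * \<bar>u - u'\<bar>) \<le> exp (2 * B) * (\<bar>\<epsilon>\<bar> * (2 * \<delta>))"
      using \<delta>(2) by (intro mult_left_mono) auto
    finally show "\<bar>exp (\<epsilon> * u) - exp (\<epsilon> * u')\<bar> \<le> exp (2 * B) * (\<bar>\<epsilon>\<bar> * (2 * \<delta>))" .
  qed (use B in auto)
  \<comment> \<open>In the first product the factors supply \<delta> and \<epsilon> respectively; in
    the second the difference of exponentials supplies both.\<close>
  moreover have "(exp (m + \<epsilon> * u) - exp m) - (exp (m' + \<epsilon> * u') - exp m')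
      = (exp m - exp m') * (exp (\<epsilon> * u) - 1) + exp m' * (exp (\<epsilon> * u) - exp (\<epsilon> * u'))"
    by (simp add: exp_add algebra_simps)
  then have "\<bar>(exp (m + \<epsilon> * u) - exp m) - (exp (m' + \<epsilon> * u') - exp m')\<bar>
      \<le> \<bar>exp m - exp m'\<bar> * \<bar>exp (\<epsilon> * u) - 1\<bar> + exp m' * \<bar>exp (\<epsilon> * u) - exp (\<epsilon> * u')\<bar>"
    using abs_triangle_ineq[of "(exp m - exp m') * (exp (\<epsilon> * u) - 1)" "exp m' * (exp (\<epsilon> * u) - exp (\<epsilon> * u'))"]
    by (simp add: abs_mult)
  moreover have "exp (3 * B) = exp B * exp (2 * B)"
    by (simp flip: exp_add)
  then have "(exp B * \<delta>) * (exp (2 * B) * (\<bar>\<epsilon>\<bar> * (2 * B))) + exp B * (exp (2 * B) * (\<bar>\<epsilon>\<bar> * (2 * \<delta>)))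
      = exp (3 * B) * (2 * B + 2) * \<bar>\<epsilon>\<bar> * \<delta>"
    by (simp only:) (simp add: algebra_simps)
  ultimately show ?thesis
    by linarith
qed

text \<open>The smallest exponent serves all functions: as y - x \<le> 2 pi, the excess power is at
  most \<open>c i\<close>. An increment of a sum of monotone functions dominates that of each
  summand. Different functions may thus satisfy different smoothness conditions.\<close>

lemma modulus_bound_common:
  fixes f :: "nat \<Rightarrow> real \<Rightarrow> complex"
  assumes "p > 0" and ex: "\<And>i. i < p \<Longrightarrow> \<exists>\<beta>>0. \<exists>G. modulus_bound \<beta> G (f i)"
  obtains \<beta> G where "\<beta> > 0" "mono_on {0..2 * pi} G" "\<And>i. i < p \<Longrightarrow> modulus_bound \<beta> G (f i)"
proof -
  obtain b G where b: "\<And>i. i < p \<Longrightarrow> b i > 0" "\<And>i. i < p \<Longrightarrow> modulus_bound (b i) (G i) (f i)"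
    using ex by metis
  define \<beta> where "\<beta> = Min (b ` {..<p})"
  have "b ` {..<p} \<noteq> {}"
    using assms(1) by auto
  then have \<beta>: "\<beta> > 0" "\<And>i. i < p \<Longrightarrow> \<beta> \<le> b i"
    using b(1) by (auto simp: \<beta>_def)
  define c where "c = (\<lambda>i. (2 * pi) powr (b i - \<beta>))"
  define H where "H = (\<lambda>t. \<Sum>i<p. c i * G i t)"
  have inc: "0 \<le> c i * G i y - c i * G i x" if "i < p" "0 \<le> x" "x \<le> y" "y \<le> 2 * pi" for i x y
    using b(2)[OF that(1)] that
    by (auto simp: modulus_bound_def c_def intro!: mult_left_mono mono_onD[of "{0..2 * pi}" "G i"])
  have le: "c i * G i y - c i * G i x \<le> H y - H x" if "i < p" "0 \<le> x" "x \<le> y" "y \<le> 2 * pi" for i x y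
    unfolding H_def sum_subtractf[symmetric]
    using member_le_sum[of i "{..<p}" "\<lambda>i. c i * G i y - c i * G i x"] inc that by auto
  have mono: "mono_on {0..2 * pi} H"
    using inc unfolding H_def by (intro mono_onI sum_mono) auto
  have "modulus_bound \<beta> H (f i)" if i: "i < p" for i
    unfolding modulus_bound_def
  proof (intro conjI allI impI mono)
    fix x y :: real assume xy: "0 \<le> x" "x \<le> y" "y \<le> 2 * pi"
    have "(norm (f i y - f i x))\<^sup>2 \<le> (y - x) powr b i * (G i y - G i x)"
      using b(2)[OF i] xy unfolding modulus_bound_def by blast
    also have "\<dots> \<le> ((y - x) powr \<beta> * c i) * (G i y - G i x)"
    proof (rule mult_right_mono)
      have "(y - x) powr b i = (y - x) powr \<beta> * (y - x) powr (b i - \<beta>)"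
        by (simp flip: powr_add)
      also have "\<dots> \<le> (y - x) powr \<beta> * c i"
        unfolding c_def using \<beta>(2)[OF i] xy by (intro mult_left_mono powr_mono2) auto
      finally show "(y - x) powr b i \<le> (y - x) powr \<beta> * c i" .
      show "0 \<le> G i y - G i x"
        using b(2)[OF i] xy by (auto simp: modulus_bound_def intro!: mono_onD[of "{0..2 * pi}" "G i"])
    qed
    also have "\<dots> = (y - x) powr \<beta> * (c i * G i y - c i * G i x)"
      by (simp add: algebra_simps)
    also have "\<dots> \<le> (y - x) powr \<beta> * (H y - H x)"
      using le[OF i xy] by (intro mult_left_mono) auto
    finally show "(norm (f i y - f i x))\<^sup>2 \<le> (y - x) powr \<beta> * (H y - H x)" .
  qed
  then show thesis
    using that \<beta>(1) mono by blast
qed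

lemma C_2pi_bounded:
  assumes "f \<in> C_2pi"
  shows "\<exists>M. \<forall>t. norm (f t) \<le> M"
proof -
  have "compact (f ` {0..2 * pi})"
    using assms by (intro compact_continuous_image) (auto simp: C_2pi_def intro: continuous_on_subset)
  then have "bounded (f ` {0..2 * pi})"
    by (rule compact_imp_bounded)
  then obtain M where M: "\<forall>x\<in>f ` {0..2 * pi}. norm x \<le> M"
    unfolding bounded_iff by blast
  have "norm (f t) \<le> M" for t
  proof -
    have "periodic f"
      using assms by (simp add: C_2pi_def)
    then obtain s where "0 \<le> s" "s \<le> 2 * pi" "f t = f s"
      by (rule periodic_reduce)
    then show ?thesis
      using M by simp
  qed
  then show ?thesis
    by blast
qed

theorem theorem18:
  fixes p :: nat and A :: "nat \<Rightarrow> ell2 \<Rightarrow> ell2" and a :: "nat \<Rightarrow> real \<Rightarrow> complex"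
  assumes "p \<ge> 3"
    and "\<And>i. i < p \<Longrightarrow> A i \<in> QT"
    and "\<And>i. i < p \<Longrightarrow> positive_definite (A i)"
    and "\<And>i. i < p \<Longrightarrow> has_symbol (A i) (a i)"
    and "\<And>i. i < p \<Longrightarrow>
          (\<exists>\<alpha>. 1/2 < \<alpha> \<and> \<alpha> \<le> 1 \<and> a i \<in> holder_2pi \<alpha>)
        \<or> (\<exists>\<alpha>. 0 < \<alpha> \<and> \<alpha> \<le> 1 \<and> a i \<in> holder_2pi \<alpha> \<and> bounded_variation_on 0 (2 * pi) (a i))
        \<or> (abs_continuous_on 0 (2 * pi) (a i) \<and> L2_derivative_on 0 (2 * pi) (a i))"
  shows "(\<forall>i<p. \<forall>k. alm_seq p a k i \<in> wiener)
       \<and> (\<lambda>t. (\<Prod>i<p. a i t) powr (1 / of_nat p)) \<in> wiener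
       \<and> (\<forall>i<p. (\<lambda>k. wiener_norm (\<lambda>t. alm_seq p a k i t - (\<Prod>i<p. a i t) powr (1 / of_nat p)))
              \<longlonglongrightarrow> 0)"
proof -
  have p: "p > 0" "real p > 0"
    using assms(1) by auto
  have C: "a i \<in> C_2pi" if "i < p" for i
    using assms(4)[OF that] by (simp add: has_symbol_def)
  have "\<exists>\<gamma>>0. \<forall>t. Im (a i t) = 0 \<and> \<gamma> \<le> Re (a i t)" if "i < p" for i
    using symbol_positive[OF assms(3,4)[OF that]] by metis
  then obtain g where g: "\<And>i. i < p \<Longrightarrow> g i > 0" "\<And>i t. i < p \<Longrightarrow> Im (a i t) = 0"
      "\<And>i t. i < p \<Longrightarrow> g i \<le> Re (a i t)"
    by metis
  define \<gamma> where "\<gamma> = Min (g ` {..<p})"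
  have "g ` {..<p} \<noteq> {}"
    using p by auto
  then have \<gamma>: "\<gamma> > 0" "\<And>i. i < p \<Longrightarrow> \<gamma> \<le> g i"
    using g(1) by (auto simp: \<gamma>_def)
  then have \<gamma>_le: "\<gamma> \<le> Re (a i t)" if "i < p" for i t
    using g(3) that by (meson order_trans)
  define l where "l = (\<lambda>i t. ln (Re (a i t)))"
  have al: "a i t = of_real (exp (l i t))" if "i < p" for i t
    using \<gamma>(1) \<gamma>_le[OF that, of t] g(2)[OF that] by (simp add: l_def complex_eq_iff)
  have cont_l: "continuous_on UNIV (l i)" and per_l: "l i (t + 2 * pi) = l i t" if "i < p" for i t
  proof -
    have "Re (a i t) \<noteq> 0" for t
      using \<gamma>(1) \<gamma>_le[OF that, of t] by simp
    then show "continuous_on UNIV (l i)"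
      unfolding l_def using C[OF that] by (auto simp: C_2pi_def intro!: continuous_intros)
    show "l i (t + 2 * pi) = l i t"
      using C[OF that] by (simp add: l_def C_2pi_def periodic_def)
  qed
  have "\<exists>M. \<forall>t. norm (complex_of_real (l i t)) \<le> M" if "i < p" for i
    by (rule C_2pi_bounded)
      (use cont_l[OF that] per_l[OF that] in \<open>auto simp: C_2pi_def periodic_def intro!: continuous_intros\<close>)
  then obtain b where b: "\<And>i t. i < p \<Longrightarrow> \<bar>l i t\<bar> \<le> b i"
    unfolding norm_of_real by metis
  define B where "B = Max (b ` {..<p})"
  have "b i \<le> B" if "i < p" for i
    using that by (simp add: B_def)
  then have lB: "\<bar>l i t\<bar> \<le> B" if "i < p" for i t
    using b that by (meson order_trans)
  have B: "0 \<le> B"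
    using lB[of 0 0] p by linarith
  have "\<exists>\<beta>>0. \<exists>G. modulus_bound \<beta> G (a i)" if "i < p" for i
    using assms(5)[OF that] modulus_bound_holder modulus_bound_bounded_variation
      modulus_bound_abs_continuous by blast
  then obtain \<beta> G where \<beta>: "\<beta> > 0" and G: "mono_on {0..2 * pi} G"
    and aG: "\<And>i. i < p \<Longrightarrow> modulus_bound \<beta> G (a i)"
    using modulus_bound_common[OF p(1)] by metis
  obtain C where C0: "\<And>f M. f \<in> C_2pi \<Longrightarrow> 0 \<le> M \<Longrightarrow> (\<And>t. norm (f t) \<le> M) \<Longrightarrow>
      modulus_bound \<beta> (\<lambda>t. M\<^sup>2 * G t) f \<Longrightarrow> f \<in> wiener \<and> wiener_norm f \<le> C * M"
    using wiener_norm_bound[OF \<beta> G] by blast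
  \<comment> \<open>The square root makes the modulus bound a linear one, |f y - f x| \<le> M * d x
    y, to which the triangle inequality applies.\<close>
  define d where "d = (\<lambda>x y. sqrt ((y - x) powr \<beta> * (G y - G x)))"
  have d2: "0 \<le> d x y" "(d x y)\<^sup>2 = (y - x) powr \<beta> * (G y - G x)"
    if "0 \<le> x" "x \<le> y" "y \<le> 2 * pi" for x y
    using mono_onD[OF G, of x y] that by (auto simp: d_def)
  \<comment> \<open>A single \<open>M\<close> bounds the values and, in units of \<open>d\<close>,
    the increments, so a factor common to both passes to the Wiener norm.\<close>
  have key: "f \<in> wiener \<and> wiener_norm f \<le> C * M"
    if "f \<in> C_2pi" "0 \<le> M" "\<And>t. norm (f t) \<le> M"
      and inc: "\<And>x y. 0 \<le> x \<Longrightarrow> x \<le> y \<Longrightarrow> y \<le> 2 * pi \<Longrightarrow> norm (f y - f x) \<le> M * d x y" for f M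
  proof (rule C0[OF that(1-3)])
    show "modulus_bound \<beta> (\<lambda>t. M\<^sup>2 * G t) f"
      unfolding modulus_bound_def
    proof (intro conjI allI impI)
      show "mono_on {0..2 * pi} (\<lambda>t. M\<^sup>2 * G t)"
        by (intro mono_onI mult_left_mono mono_onD[OF G]) auto
      fix x y :: real assume xy: "0 \<le> x" "x \<le> y" "y \<le> 2 * pi"
      have "(norm (f y - f x))\<^sup>2 \<le> (M * d x y)\<^sup>2"
        using inc[OF xy] by (intro power_mono) auto
      then show "(norm (f y - f x))\<^sup>2 \<le> (y - x) powr \<beta> * (M\<^sup>2 * G y - M\<^sup>2 * G x)"
        unfolding power_mult_distrib d2(2)[OF xy] by (simp add: algebra_simps)
    qed
  qed
  define m where "m = (\<lambda>t. (\<Sum>j<p. l j t) / real p)"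
  \<comment> \<open>1 / \<gamma> is the Lipschitz constant of \<open>ln\<close> above \<gamma>. The
    maximum with 1 lets \<open>E\<close> below dominate also the bounds on values, where no
    \<open>c\<close> occurs.\<close>
  define c where "c = max 1 (1 / \<gamma>)"
  have c: "1 \<le> c" "1 / \<gamma> \<le> c"
    by (auto simp: c_def)
  have l_inc: "\<bar>l i y - l i x\<bar> \<le> c * d x y" if "i < p" "0 \<le> x" "x \<le> y" "y \<le> 2 * pi" for i x y
  proof -
    have "norm (a i y - a i x) \<le> d x y"
      using aG[OF that(1)] d2[OF that(2-4)] that(2-4)
      by (intro power2_le_imp_le[of "norm (a i y - a i x)"]) (auto simp: modulus_bound_def)
    then have "\<bar>Re (a i y) - Re (a i x)\<bar> \<le> d x y"
      using abs_Re_le_cmod[of "a i y - a i x"] by simp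
    then have "\<bar>l i y - l i x\<bar> \<le> d x y / \<gamma>"
      unfolding l_def using \<gamma>(1) \<gamma>_le[OF that(1)]
      by (intro order_trans[OF abs_ln_diff_le[of \<gamma>]] divide_right_mono) auto
    also have "\<dots> \<le> c * d x y"
      using mult_right_mono[OF c(2) d2(1)[OF that(2-4)]] by simp
    finally show ?thesis .
  qed
  have mean_le: "\<bar>(\<Sum>j<p. h j) / real p\<bar> \<le> K" if "\<And>j. j < p \<Longrightarrow> \<bar>h j\<bar> \<le> K" for h and K :: real
  proof -
    have "\<bar>\<Sum>j<p. h j\<bar> \<le> (\<Sum>j<p. K)"
      by (intro order_trans[OF sum_abs] sum_mono that) auto
    then show ?thesis
      using p by (simp add: field_simps)
  qed
  have mB: "\<bar>m t\<bar> \<le> B" for t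
    unfolding m_def by (intro mean_le lB)
  have m_inc: "\<bar>m y - m x\<bar> \<le> c * d x y" if "0 \<le> x" "x \<le> y" "y \<le> 2 * pi" for x y
    unfolding m_def using mean_le[of "\<lambda>j. l j y - l j x"] l_inc that
    by (simp add: sum_subtractf diff_divide_distrib)
  have m_cont: "continuous_on UNIV m" and m_per: "m (t + 2 * pi) = m t" for t
    unfolding m_def using cont_l p per_l by (auto intro!: continuous_intros)
  \<comment> \<open>The constant for perturbed increments with \<delta> = c * d x y; it also covers
    the values and increments of the limit and the values of the differences.\<close>
  define E where "E = exp (3 * B) * (2 * B + 2) * c"
  have E_ge: "exp (3 * B) * (2 * B + 2) \<le> E"
    unfolding E_def using mult_left_mono[OF c(1), of "exp (3 * B) * (2 * B + 2)"] B by simp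
  have E: "0 \<le> E"
    using B c(1) by (simp add: E_def)
  \<comment> \<open>From here on \<open>g\<close> is the limit function, no longer the family of
    lower bounds.\<close>
  define g where "g = (\<lambda>t. complex_of_real (exp (m t)))"
  have g_bound: "norm (g t) \<le> E" for t
  proof -
    have "exp (m t) \<le> exp (3 * B)"
      using mB[of t] B by (simp add: abs_le_iff)
    also have "\<dots> \<le> exp (3 * B) * (2 * B + 2)"
      using B by simp
    finally show ?thesis
      using E_ge by (simp add: g_def)
  qed
  have g_inc: "norm (g y - g x) \<le> E * d x y" if xy: "0 \<le> x" "x \<le> y" "y \<le> 2 * pi" for x y
  proof -
    have "\<bar>exp (m y) - exp (m x)\<bar> \<le> exp (3 * B) * \<bar>m y - m x\<bar>"
      using mB[of x] mB[of y] B by (intro abs_exp_diff_le) (auto simp: abs_le_iff)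
    also have "\<dots> \<le> exp (3 * B) * (c * d x y)"
      using m_inc[OF xy] by (intro mult_left_mono) auto
    also have "\<dots> \<le> exp (3 * B) * (2 * B + 2) * (c * d x y)"
      using B c(1) d2(1)[OF xy] by (intro mult_right_mono) auto
    finally show ?thesis
      by (simp add: g_def E_def mult.assoc flip: of_real_diff)
  qed
  have g_C: "g \<in> C_2pi"
    using m_cont m_per by (auto simp: g_def C_2pi_def periodic_def intro!: continuous_intros)
  \<comment> \<open>As p \<ge> 3, the contraction factor has absolute value at most 1/2.\<close>
  define r where "r = - 1 / real (p - 1)"
  have r: "\<bar>r\<bar> < 1"
    using assms(1) by (auto simp: r_def)
  then have rk: "\<bar>r ^ k\<bar> \<le> 1" for k
    unfolding power_abs by (intro power_le_one) auto
  define s where "s = (\<lambda>k i t. complex_of_real (exp (m t + r ^ k * (l i t - m t))))"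
  have s_C: "s k i \<in> C_2pi" if "i < p" for k i
    using m_cont m_per cont_l[OF that] per_l[OF that]
    by (auto simp: s_def C_2pi_def periodic_def intro!: continuous_intros)
  have sg_bound: "norm (s k i t - g t) \<le> E * \<bar>r ^ k\<bar>" if "i < p" for k i t
  proof -
    have "\<bar>l i t - m t\<bar> \<le> 2 * B"
      using lB[OF that, of t] mB[of t] by linarith
    then have "norm (s k i t - g t) \<le> exp (3 * B) * (2 * B) * \<bar>r ^ k\<bar>"
      using abs_exp_perturbation_le[OF mB _ rk] by (simp add: s_def g_def flip: of_real_diff)
    also have "\<dots> \<le> exp (3 * B) * (2 * B + 2) * \<bar>r ^ k\<bar>"
      by (intro mult_right_mono mult_left_mono) auto
    also have "\<dots> \<le> E * \<bar>r ^ k\<bar>"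
      using E_ge by (intro mult_right_mono) auto
    finally show ?thesis .
  qed
  have sg_inc: "norm ((s k i y - g y) - (s k i x - g x)) \<le> (E * \<bar>r ^ k\<bar>) * d x y"
    if i: "i < p" and xy: "0 \<le> x" "x \<le> y" "y \<le> 2 * pi" for k i x y
  proof -
    have "\<bar>l i t - m t\<bar> \<le> 2 * B" for t
      using lB[OF i, of t] mB[of t] by linarith
    moreover have "\<bar>(l i y - m y) - (l i x - m x)\<bar> \<le> 2 * (c * d x y)"
      using l_inc[OF i xy] m_inc[OF xy] by linarith
    ultimately have "\<bar>(exp (m y + r ^ k * (l i y - m y)) - exp (m y)) - (exp (m x + r ^ k * (l i x - m x)) - exp (m x))\<bar>
        \<le> exp (3 * B) * (2 * B + 2) * \<bar>r ^ k\<bar> * (c * d x y)"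
      using mB rk m_inc[OF xy] by (intro abs_exp_perturbation_diff_le)
    then show ?thesis
      by (simp add: s_def g_def E_def mult_ac flip: of_real_diff)
  qed
  have g_wiener: "g \<in> wiener"
    using key[OF g_C E g_bound g_inc] by blast
  \<comment> \<open>The bounds for s - g and for g add up, so the criterion applies to the iterate
    itself.\<close>
  have s_wiener: "s k i \<in> wiener" if i: "i < p" for k i
  proof -
    define M where "M = E * \<bar>r ^ k\<bar> + E"
    have "norm (s k i t) \<le> M" for t
      using norm_triangle_ineq[of "s k i t - g t" "g t"] sg_bound[OF i, of k t] g_bound[of t]
      unfolding M_def by simp
    moreover have "norm (s k i y - s k i x) \<le> M * d x y" if xy: "0 \<le> x" "x \<le> y" "y \<le> 2 * pi" for x y
      using norm_triangle_ineq[of "(s k i y - g y) - (s k i x - g x)" "g y - g x"]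
        sg_inc[OF i xy, of k] g_inc[OF xy] unfolding M_def by (simp add: distrib_right)
    moreover have "0 \<le> M"
      using E by (simp add: M_def)
    ultimately show ?thesis
      using key[OF s_C[OF i]] by blast
  qed
  have diff_norm: "wiener_norm (\<lambda>t. s k i t - g t) \<le> C * (E * \<bar>r ^ k\<bar>)" if i: "i < p" for k i
  proof -
    have "(\<lambda>t. s k i t - g t) \<in> C_2pi"
      using s_C[OF i, of k] g_C by (auto simp: C_2pi_def periodic_def intro!: continuous_intros)
    then show ?thesis
      using key[of "\<lambda>t. s k i t - g t" "E * \<bar>r ^ k\<bar>"] sg_bound[OF i] sg_inc[OF i] E by simp
  qed
  have lim: "(\<lambda>k. wiener_norm (\<lambda>t. s k i t - g t)) \<longlonglongrightarrow> 0" if i: "i < p" for i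
  proof (rule tendsto_sandwich)
    show "\<forall>\<^sub>F k in sequentially. 0 \<le> wiener_norm (\<lambda>t. s k i t - g t)"
      by (simp add: wiener_norm_def infsum_nonneg)
    show "\<forall>\<^sub>F k in sequentially. wiener_norm (\<lambda>t. s k i t - g t) \<le> C * (E * \<bar>r\<bar> ^ k)"
      using diff_norm[OF i] by (simp add: power_abs)
    have "(\<lambda>k. C * (E * \<bar>r\<bar> ^ k)) \<longlonglongrightarrow> C * (E * 0)"
      using r by (intro tendsto_intros LIMSEQ_power_zero) simp
    then show "(\<lambda>k. C * (E * \<bar>r\<bar> ^ k)) \<longlonglongrightarrow> 0"
      by simp
  qed simp
  have seq: "alm_seq p a k i = s k i" if "i < p" for k i
    using alm_seq_exp[OF assms(1) that al] by (auto simp: fun_eq_iff s_def m_def r_def)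
  have mean: "(\<Prod>i<p. a i t) powr (1 / of_nat p) = g t" for t
  proof -
    have "(\<Prod>i<p. a i t) = of_real (exp (\<Sum>i<p. l i t))"
      by (simp add: al exp_sum)
    then have "(\<Prod>i<p. a i t) powr (1 / of_nat p) = of_real (exp (\<Sum>i<p. l i t)) powr of_real (1 / real p)"
      by simp
    also have "\<dots> = of_real (exp (\<Sum>i<p. l i t) powr (1 / real p))"
      by (rule powr_of_real) auto
    finally show ?thesis
      by (simp add: g_def m_def exp_powr_real)
  qed
  show ?thesis
    unfolding mean using s_wiener g_wiener lim by (simp add: seq)
qed

end
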